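(* Let $a\in\operatorname{M}_\Lambda$, $b\in\operatorname{M}_\Lambda^\times$, and let $k\ge1$ be an integer. Let $p_1\in\Theta_k\cup\{0\}$ and $p_2,p_3\in\Theta_k$ be such that $a=p_1/p_3$ and $b=p_2/p_3$. Let $u\in\operatorname{M}_{k\Lambda}$ be a solution of the Riccati equation $(\phi(u)+a)u=-b$. Then $$u=\frac{\phi(r)}{r}\,\frac{p}{q}$$ for some $p,q,r\in\Theta_k$ such that (i) $\operatorname{div}_k(p)\le\operatorname{div}_k(p_2)$, (ii) $\operatorname{div}_k(q)\le\operatorname{div}_k(\phi^{-1}(p_3))$, (iii) $\deg_k(p)=\deg_k(q)$, (iv) $\omega_k(p/q)=\deg_k(r)\,h \bmod k\Lambda$.
   Context: $\Lambda=\mathbb Z+\mathbb Z\tau\subset\mathbb C$ with $\Im(\tau)>0$; $h\in\mathbb C$ is such that $h\bmod\Lambda$ is not a torsion point of $\mathbb C/\Lambda$. For a lattice $\Lambda'\subset\mathbb C$, $\operatorname{M}_{\Lambda'}$ is the field of $\Lambda'$-periodic meromorphic functions on $\mathbb C$. For a meromorphic function $f$ on $\mathbb C$, $\phi(f)(z)=f(z+h)$. $\theta(z)=\sum_{m\in\mathbb Z}(-1)^m e^{i\pi m(m-1)\tau}e^{2i\pi mz}$ and, for an integer $k\ge1$, $\theta_k(z)=\theta(z/k)$; it is entire, $k$-periodic, its zeroes are simple and its set of zeroes is $k\Lambda$. $\Theta_k$ is the set of entire functions $c\prod_{\xi\in\mathbb C}\theta_k(z-\xi)^{n_\xi}$ with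 $c\in\mathbb C^\times$ and $(n_\xi)_{\xi\in\mathbb C}$ a finitely supported family of nonnegative integers; $\Theta_k^{\rm quot}$ is the set of meromorphic functions that are quotients of two elements of $\Theta_k$. For $f\in\Theta_k^{\rm quot}$ and $\lambda\in\mathbb C/k\Lambda$, $\operatorname{ord}_\lambda(f)$ is the order of vanishing of $f$ at any $\xi\in\lambda$ (independent of $\xi$). The divisor is the formal sum $\operatorname{div}_k(f)=\sum_{\lambda\in\mathbb C/k\Lambda}\operatorname{ord}_\lambda(f)[\lambda]$, the weight is $\omega_k(f)=\sum_{\lambda}\operatorname{ord}_\lambda(f)\lambda\in\mathbb C/k\Lambda$, and the degree is $\deg_k(f)=\sum_\lambda\operatorname{ord}_\lambda(f)\in\mathbb Z$. One writes $\sum n_\lambda[\lambda]\le\sum m_\lambda[\lambda]$ if $n_\lambda\le m_\lambda$ for all $\lambda$. *)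

theory Defs
  imports "HOL-Complex_Analysis.Complex_Analysis" "HOL-Algebra.Coset" "HOL-Algebra.FiniteProduct"
begin

text \<open>
  Meromorphic functions on the complex plane are represented by total functions, normalised by
  \<^const>\<open>nicely_meromorphic_on\<close> (continuous where there is no pole, value \<open>0\<close> at the poles), so that
  each meromorphic function has exactly one representative. Pointwise sums, products and quotients
  of representatives need not be normalised; equality in the field of meromorphic functions is
  therefore equality outside a sparse set, written \<open>\<forall>\<^sub>\<approx>z. f z = g z\<close>.
\<close>

definition period_lattice :: "complex \<Rightarrow> nat \<Rightarrow> complex set" where
  "period_lattice \<tau> k = {of_nat k * (of_int m + of_int n * \<tau>) | m n :: int. True}"

definition periodic_mero :: "complex set \<Rightarrow> (complex \<Rightarrow> complex) set" where
  "periodic_mero L = {f. f nicely_meromorphic_on UNIV \<and> (\<forall>w\<in>L. \<forall>z. f (z + w) = f z)}"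

definition shift :: "complex \<Rightarrow> (complex \<Rightarrow> complex) \<Rightarrow> complex \<Rightarrow> complex" where
  "shift h f = (\<lambda>z. f (z + h))"

lemma shift_inverse: "shift h \<circ> shift (- h) = id" "shift (- h) \<circ> shift h = id"
  by (auto simp: shift_def fun_eq_iff)

definition theta :: "complex \<Rightarrow> complex \<Rightarrow> complex" where
  "theta \<tau> z = (\<Sum>\<^sub>\<infinity>m::int. (-1) powi m * exp (\<i> * of_real pi * of_int (m * (m - 1)) * \<tau>)
                               * exp (2 * \<i> * of_real pi * of_int m * z))"

definition theta_k :: "complex \<Rightarrow> nat \<Rightarrow> complex \<Rightarrow> complex" where
  "theta_k \<tau> k z = theta \<tau> (z / of_nat k)"

definition Theta :: "complex \<Rightarrow> nat \<Rightarrow> (complex \<Rightarrow> complex) set" where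
  "Theta \<tau> k = {(\<lambda>z. c * (\<Prod>\<xi> | n \<xi> \<noteq> 0. theta_k \<tau> k (z - \<xi>) ^ n \<xi>)) | c (n :: complex \<Rightarrow> nat).
                  c \<noteq> 0 \<and> finite {\<xi>. n \<xi> \<noteq> 0}}"

definition complex_add :: "complex monoid" where
  "complex_add = \<lparr>carrier = UNIV, mult = (+), one = 0\<rparr>"

text \<open>
  The group \<open>\<complex>/k\<Lambda>\<close>, written multiplicatively as everywhere in HOL-Algebra; its elements are the
  cosets of \<open>k\<Lambda>\<close>.
\<close>

definition torus :: "complex \<Rightarrow> nat \<Rightarrow> complex set monoid" where
  "torus \<tau> k = complex_add Mod period_lattice \<tau> k"

definition torus_class :: "complex \<Rightarrow> nat \<Rightarrow> complex \<Rightarrow> complex set" where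
  "torus_class \<tau> k z = period_lattice \<tau> k #>\<^bsub>complex_add\<^esub> z"

lemma comm_group_complex_add: "comm_group complex_add"
  by (rule comm_groupI) (auto simp: complex_add_def intro: exI[of _ "- x" for x :: complex] left_minus)

lemma subgroup_period_lattice: "subgroup (period_lattice \<tau> k) complex_add"
proof -
  interpret comm_group complex_add by (rule comm_group_complex_add)
  have inv_eq: "inv\<^bsub>complex_add\<^esub> x = - x" for x
    by (rule inv_equality) (auto simp: complex_add_def)
  show ?thesis
  proof (rule subgroupI)
    have "of_nat k * (of_int 0 + of_int 0 * \<tau>) \<in> period_lattice \<tau> k"
      unfolding period_lattice_def by blast
    then show "period_lattice \<tau> k \<noteq> {}" by blast
  next
    fix x assume "x \<in> period_lattice \<tau> k"
    then obtain m n where x: "x = of_nat k * (of_int m + of_int n * \<tau>)"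
      by (auto simp: period_lattice_def)
    have "- x = of_nat k * (of_int (- m) + of_int (- n) * \<tau>)"
      by (simp add: x algebra_simps)
    then show "inv\<^bsub>complex_add\<^esub> x \<in> period_lattice \<tau> k"
      unfolding inv_eq period_lattice_def by blast
  next
    fix x y assume "x \<in> period_lattice \<tau> k" "y \<in> period_lattice \<tau> k"
    then obtain m n m' n' where xy: "x = of_nat k * (of_int m + of_int n * \<tau>)"
      "y = of_nat k * (of_int m' + of_int n' * \<tau>)"
      by (auto simp: period_lattice_def)
    have "x + y = of_nat k * (of_int (m + m') + of_int (n + n') * \<tau>)"
      by (simp add: xy algebra_simps)
    then show "x \<otimes>\<^bsub>complex_add\<^esub> y \<in> period_lattice \<tau> k"
      unfolding complex_add_def period_lattice_def mem_Collect_eq monoid.simps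
      by (intro exI conjI TrueI)
  qed (auto simp: complex_add_def)
qed

lemma comm_group_torus: "comm_group (torus \<tau> k)"
  unfolding torus_def
  by (intro comm_group.abelian_FactGroup comm_group_complex_add subgroup_period_lattice)

text \<open>
  Order along a coset: the common value of \<^const>\<open>zorder\<close> at its points. It is meaningful for
  quotients of elements of \<^const>\<open>Theta\<close>, for which this value does not depend on the point. Since
  \<^const>\<open>zorder\<close> only looks at punctured neighbourhoods, such a quotient can be taken pointwise.
\<close>

definition ord_class :: "(complex \<Rightarrow> complex) \<Rightarrow> complex set \<Rightarrow> int" where
  "ord_class f C = the_elem (zorder f ` C)"

text \<open>
  A divisor is its coefficient function, extended by \<open>0\<close> off the cosets of \<open>k\<Lambda>\<close>, so that the order
  on divisors is the pointwise order on functions.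
\<close>

definition theta_div :: "complex \<Rightarrow> nat \<Rightarrow> (complex \<Rightarrow> complex) \<Rightarrow> complex set \<Rightarrow> int" where
  "theta_div \<tau> k f C = (if C \<in> carrier (torus \<tau> k) then ord_class f C else 0)"

definition theta_weight :: "complex \<Rightarrow> nat \<Rightarrow> (complex \<Rightarrow> complex) \<Rightarrow> complex set" where
  "theta_weight \<tau> k f =
     (\<Otimes>\<^bsub>torus \<tau> k\<^esub>C\<in>{C. theta_div \<tau> k f C \<noteq> 0}. C [^]\<^bsub>torus \<tau> k\<^esub> theta_div \<tau> k f C)"

definition theta_deg :: "complex \<Rightarrow> nat \<Rightarrow> (complex \<Rightarrow> complex) \<Rightarrow> int" where
  "theta_deg \<tau> k f = (\<Sum>C | theta_div \<tau> k f C \<noteq> 0. theta_div \<tau> k f C)"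

end

theory Submission
  imports Defs
begin

text \<open>
  A divisor on \<open>\<complex>/k\<Lambda>\<close> is realised by a product of translates of \<open>\<theta>\<^sub>k\<close>, because the zeros of
  \<open>\<theta>\<close> are simple and form \<open>\<Lambda>\<close>: the quotient of \<open>\<theta>\<close> by the infinite product
  \<open>\<Prod>\<^sub>n (1 - q\<^sup>n w) \<cdot> \<Prod>\<^sub>n (1 - q\<^sup>n\<^sup>+\<^sup>1 / w)\<close> is entire and elliptic, hence constant.

  Let \<open>N\<close> and \<open>P\<close> be the divisors of zeros and of poles of \<open>u\<close>, and let \<open>r\<close> have divisor
  \<open>gcd (\<phi>\<^sup>-\<^sup>1 N, P)\<close>. Then \<open>div u = div (\<phi> r / r) + (N - \<phi> (div r)) - (P - div r)\<close>, and comparing orders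
  on both sides of \<open>(\<phi> u \<cdot> p\<^sub>3 + p\<^sub>1) u = - p\<^sub>2\<close> shows that \<open>N - \<phi> (div r) \<le> div p\<^sub>2\<close> and
  \<open>P - div r \<le> \<phi>\<^sup>-\<^sup>1 (div p\<^sub>3)\<close>. Hence \<open>u\<close> equals \<open>\<phi> r / r \<cdot> p / q\<close> up to a nonvanishing entire
  function whose quasi-periods are exponentials of affine functions. Such a function is
  \<open>c exp (2 \<pi> \<i> n z / k)\<close>, which yields the degree and the weight conditions, and the exponential is
  absorbed into \<open>p\<close> by moving one zero by a multiple of \<open>k \<tau>\<close>. If \<open>p\<close> has no zero, the weight condition
  says that \<open>deg r \<cdot> h \<in> k\<Lambda>\<close>; since \<open>h\<close> is not torsion, \<open>r\<close> is constant and \<open>n = 0\<close>.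
\<close>

section \<open>Nonzero meromorphic functions on the plane\<close>

text \<open>These functions represent the nonzero elements of the field of meromorphic functions.
  Values at singularities are left free, so the class is closed under pointwise products and
  quotients, and \<open>zorder\<close> is additive on it.\<close>

definition nz_meromorphic :: "(complex \<Rightarrow> complex) \<Rightarrow> bool" where
  "nz_meromorphic f \<longleftrightarrow> f meromorphic_on UNIV \<and> (\<forall>\<^sub>\<approx>z. f z \<noteq> 0)"

lemma eventually_cosparse_UNIV: "(\<forall>\<^sub>\<approx>z. P z) \<longleftrightarrow> (\<forall>z. eventually P (at z))"
  by (simp add: eventually_cosparse_open_eq)

lemma eventually_at_shift:
  fixes w z :: complex
  shows "eventually P (at (z + w)) \<longleftrightarrow> eventually (\<lambda>z. P (z + w)) (at z)"
proof -
  have "at (z + w) = filtermap (\<lambda>z. z + w) (at z)"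
    using filtermap_at_shift [of "- w" z] by simp
  then show ?thesis
    by (simp add: eventually_filtermap)
qed

lemma cosparse_shift:
  fixes w :: complex
  assumes "\<forall>\<^sub>\<approx>z. P z"
  shows "\<forall>\<^sub>\<approx>z. P (z + w)"
  using assms by (simp add: eventually_cosparse_UNIV flip: eventually_at_shift)

lemma nz_meromorphicD:
  assumes "nz_meromorphic f"
  shows "f meromorphic_on A" "eventually (\<lambda>z. f z \<noteq> 0) (at z)" "frequently (\<lambda>z. f z \<noteq> 0) (at z)"
proof -
  show "f meromorphic_on A"
    using assms meromorphic_on_subset by (auto simp: nz_meromorphic_def)
  show "eventually (\<lambda>z. f z \<noteq> 0) (at z)"
    using assms by (auto simp: nz_meromorphic_def eventually_cosparse_UNIV)
  then show "frequently (\<lambda>z. f z \<noteq> 0) (at z)"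
    by (intro eventually_frequently) auto
qed

lemma nz_meromorphic_mult:
  "nz_meromorphic f \<Longrightarrow> nz_meromorphic g \<Longrightarrow> nz_meromorphic (\<lambda>z. f z * g z)"
  by (auto simp: nz_meromorphic_def elim: eventually_elim2 intro: meromorphic_intros)

lemma nz_meromorphic_divide:
  "nz_meromorphic f \<Longrightarrow> nz_meromorphic g \<Longrightarrow> nz_meromorphic (\<lambda>z. f z / g z)"
  by (auto simp: nz_meromorphic_def elim: eventually_elim2 intro: meromorphic_intros)

lemma nz_meromorphic_const: "c \<noteq> 0 \<Longrightarrow> nz_meromorphic (\<lambda>_. c)"
  by (auto simp: nz_meromorphic_def)

lemma nz_meromorphic_power: "nz_meromorphic f \<Longrightarrow> nz_meromorphic (\<lambda>z. f z ^ n)"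
  by (induction n) (auto intro: nz_meromorphic_mult nz_meromorphic_const)

lemma nz_meromorphic_prod:
  "(\<And>x. x \<in> A \<Longrightarrow> nz_meromorphic (f x)) \<Longrightarrow> nz_meromorphic (\<lambda>z. \<Prod>x\<in>A. f x z)"
  by (induction A rule: infinite_finite_induct)
     (auto intro: nz_meromorphic_mult nz_meromorphic_const)

lemma nz_meromorphic_shift: assumes "nz_meromorphic f" shows "nz_meromorphic (\<lambda>z. f (z + w))"
proof -
  have "(\<lambda>z. f (z + w)) meromorphic_on UNIV"
    by (rule meromorphic_on_compose [of f UNIV])
      (use assms in \<open>auto simp: nz_meromorphic_def intro!: analytic_intros\<close>)
  then show ?thesis
    using assms cosparse_shift by (auto simp: nz_meromorphic_def)
qed

text \<open>Identity theorem: on the connected plane an entire function is constantly 0 or nonzero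
  off a sparse set, and the value at \<open>a\<close> excludes the former.\<close>

lemma nz_meromorphic_holomorphic:
  assumes "f holomorphic_on UNIV" "f a \<noteq> 0"
  shows "nz_meromorphic f"
proof -
  have "f analytic_on UNIV"
    using assms by (simp add: analytic_on_open)
  then have "f nicely_meromorphic_on UNIV"
    by (rule analytic_on_imp_nicely_meromorphic_on)
  with nicely_meromorphic_imp_constant_or_avoid [of f UNIV 0] assms(2) show ?thesis
    by (auto simp: nz_meromorphic_def nicely_meromorphic_on_def)
qed

section \<open>Orders of vanishing\<close>

lemma zorder_nz_mult:
  "nz_meromorphic f \<Longrightarrow> nz_meromorphic g \<Longrightarrow> zorder (\<lambda>z. f z * g z) z = zorder f z + zorder g z"
  by (intro zorder_mult nz_meromorphicD)

lemma zorder_nz_divide: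
  "nz_meromorphic f \<Longrightarrow> nz_meromorphic g \<Longrightarrow> zorder (\<lambda>z. f z / g z) z = zorder f z - zorder g z"
  by (intro zorder_divide nz_meromorphicD)

lemma zorder_nz_power: "nz_meromorphic f \<Longrightarrow> zorder (\<lambda>z. f z ^ n) z = int n * zorder f z"
  by (intro zorder_power nz_meromorphicD)

lemma zorder_nz_prod:
  assumes "\<And>x. x \<in> A \<Longrightarrow> nz_meromorphic (f x)"
  shows "zorder (\<lambda>z. \<Prod>x\<in>A. f x z) z = (\<Sum>x\<in>A. zorder (f x) z)"
  using assms by (intro zorder_prod nz_meromorphicD [OF nz_meromorphic_prod]) (auto intro: nz_meromorphicD)

lemma zorder_at_shift: "zorder (\<lambda>z. f (z + w)) z = zorder f (z + w)"
  by (subst zorder_shift, subst (2) zorder_shift) (simp add: add.assoc)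

lemma zorder_cosparse_cong:
  assumes "\<forall>\<^sub>\<approx>z. f z = g z"
  shows "zorder f z = zorder g z"
  using assms by (intro zorder_cong) (auto simp: eventually_cosparse_UNIV)

lemma zorder_entire_nonzero: "e holomorphic_on UNIV \<Longrightarrow> e z \<noteq> 0 \<Longrightarrow> zorder e z = 0"
  by (intro zorder_eq_0I) (auto simp: analytic_at)

text \<open>The multiplier \<open>e\<close> is entire without zeros, so it contributes order 0 at
  every point.\<close>

lemma zorder_quasi_periodic:
  assumes "nz_meromorphic f" "e holomorphic_on UNIV" "\<And>z. e z \<noteq> 0" "\<And>z. f (z + w) = e z * f z"
  shows "zorder f (z + w) = zorder f z"
proof -
  have "zorder f (z + w) = zorder (\<lambda>z. e z * f z) z"
    by (simp flip: zorder_at_shift assms(4))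
  also have "\<dots> = zorder e z + zorder f z"
    by (rule zorder_nz_mult [OF nz_meromorphic_holomorphic [OF assms(2,3)] assms(1)])
  finally show ?thesis
    using assms by (simp add: zorder_entire_nonzero)
qed

lemma zorder_entire_nonneg:
  assumes "nz_meromorphic f" "f holomorphic_on UNIV"
  shows "zorder f z \<ge> 0"
  using assms by (intro zorder_ge_0 nz_meromorphicD) (auto simp: analytic_at)

lemma zorder_entire_pos_iff:
  assumes "nz_meromorphic f" "f holomorphic_on UNIV"
  shows "zorder f z > 0 \<longleftrightarrow> f z = 0"
  using assms by (intro zorder_pos_iff' nz_meromorphicD) (auto simp: analytic_at)

lemma holomorphic_cosparse_eq:
  assumes "f holomorphic_on UNIV" "g holomorphic_on UNIV" "\<forall>\<^sub>\<approx>z. f z = g z"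
  shows "f = g"
proof
  fix z
  have "isCont f z" "isCont g z"
    using assms(1,2)
    by (meson UNIV_I continuous_on_eq_continuous_at holomorphic_on_imp_continuous_on open_UNIV)+
  then have "f \<midarrow>z\<rightarrow> f z" "g \<midarrow>z\<rightarrow> g z"
    by (auto simp: isCont_def)
  moreover have "\<forall>\<^sub>F z in at z. f z = g z"
    using assms(3) by (simp add: eventually_cosparse_UNIV)
  ultimately show "f z = g z"
    by (metis tendsto_cong tendsto_unique trivial_limit_at)
qed

text \<open>Nonnegative order rules out poles, so every singularity is removable; \<open>F\<close>
  is \<open>f\<close> with its singularities filled in.\<close>

lemma zorder_nonneg_imp_entire:
  assumes "nz_meromorphic f" "\<And>z. zorder f z \<ge> 0"
  obtains F where "F holomorphic_on UNIV" "\<forall>\<^sub>\<approx>z. F z = f z"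
proof
  show "\<forall>\<^sub>\<approx>z. remove_sings f z = f z"
    by (intro eventually_remove_sings_eq nz_meromorphicD assms)
  have "remove_sings f analytic_on {z}" for z
  proof -
    have sing: "isolated_singularity_at f z" "not_essential f z"
      using nz_meromorphicD(1) [OF assms(1), of "{z}"] by (auto simp: meromorphic_at_iff)
    moreover have "\<not> is_pole f z"
      using isolated_pole_imp_neg_zorder [of f z] assms(2) [of z] sing by force
    ultimately show ?thesis
      using remove_sings_analytic_at by (auto simp: not_essential_def)
  qed
  then show "remove_sings f holomorphic_on UNIV"
    by (meson analytic_imp_holomorphic analytic_on_analytic_at)
qed

text \<open>For transferring nonvanishing from a known \<open>g\<close>: in the uses,
  \<open>f\<close> is a factor of \<open>g\<close> up to sign or agrees with \<open>g\<close> off a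
  sparse set.\<close>

lemma nz_meromorphic_cong:
  assumes "f meromorphic_on UNIV" "nz_meromorphic g" "\<forall>\<^sub>\<approx>z. g z \<noteq> 0 \<longrightarrow> f z \<noteq> 0"
  shows "nz_meromorphic f"
proof -
  have "\<forall>\<^sub>\<approx>z. g z \<noteq> 0"
    using assms(2) by (simp add: nz_meromorphic_def)
  with assms(3) have "\<forall>\<^sub>\<approx>z. f z \<noteq> 0"
    by eventually_elim simp
  with assms(1) show ?thesis
    by (simp add: nz_meromorphic_def)
qed

text \<open>The zero function is a separate alternative because \<open>zorder\<close> carries no
  information there; this admits \<open>p1 = 0\<close> later.\<close>

lemma zorder_nz_add_ge:
  assumes "nz_meromorphic f" "nz_meromorphic (\<lambda>z. f z + g z)"
    and "g = (\<lambda>_. 0) \<or> nz_meromorphic g \<and> zorder g z \<ge> c" "zorder f z \<ge> c"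
  shows "zorder (\<lambda>z. f z + g z) z \<ge> c"
proof (cases "g = (\<lambda>_. 0)")
  case False
  then have "nz_meromorphic g" "zorder g z \<ge> c"
    using assms(3) by auto
  then show ?thesis
    using assms by (intro zorder_add_ge nz_meromorphicD) auto
qed (use assms(4) in simp)

text \<open>Off a sparse set the function is analytic and nonzero. With \<open>finite_supp\<close>
  this makes divisors on the torus finite.\<close>

lemma zorder_eq_0_cosparse:
  assumes "nz_meromorphic f"
  shows "\<forall>\<^sub>\<approx>z. zorder f z = 0"
proof -
  have "\<forall>\<^sub>\<approx>z. f analytic_on {z}" "\<forall>\<^sub>\<approx>z. f z \<noteq> 0"
    using assms by (auto simp: nz_meromorphic_def intro: meromorphic_on_imp_analytic_cosparse)
  then show ?thesis
    by eventually_elim (rule zorder_eq_0I)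
qed

lemma holomorphic_on_shift:
  assumes "f holomorphic_on UNIV"
  shows "(\<lambda>z. f (z + w)) holomorphic_on UNIV"
  using holomorphic_on_compose_gen [OF _ assms, of "\<lambda>z. z + w" UNIV]
  by (simp add: o_def holomorphic_on_add)

section \<open>Period lattices and elliptic functions\<close>

lemma period_latticeI: "of_nat k * (of_int m + of_int n * \<tau>) \<in> period_lattice \<tau> k"
  unfolding period_lattice_def by blast

lemma period_latticeE:
  assumes "w \<in> period_lattice \<tau> k"
  obtains m n where "w = of_nat k * (of_int m + of_int n * \<tau>)"
  using assms unfolding period_lattice_def by blast

lemma period_lattice_add:
  "v \<in> period_lattice \<tau> k \<Longrightarrow> w \<in> period_lattice \<tau> k \<Longrightarrow> v + w \<in> period_lattice \<tau> k"
  using subgroup.m_closed [OF subgroup_period_lattice, of v \<tau> k w] by (simp add: complex_add_def)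

lemma period_lattice_uminus:
  assumes "v \<in> period_lattice \<tau> k" shows "- v \<in> period_lattice \<tau> k"
proof -
  obtain m n where "v = of_nat k * (of_int m + of_int n * \<tau>)"
    using assms by (rule period_latticeE)
  then have "- v = of_nat k * (of_int (- m) + of_int (- n) * \<tau>)"
    by (simp add: algebra_simps)
  then show ?thesis
    by (simp only: period_latticeI)
qed

lemma period_lattice_0: "0 \<in> period_lattice \<tau> k"
  using period_latticeI [of k 0 0 \<tau>] by simp

lemma period_lattice_diff:
  "v \<in> period_lattice \<tau> k \<Longrightarrow> w \<in> period_lattice \<tau> k \<Longrightarrow> v - w \<in> period_lattice \<tau> k"
  using period_lattice_add [of v \<tau> k "- w"] period_lattice_uminus [of w \<tau> k] by simp

lemma period_lattice_subset_1: "period_lattice \<tau> k \<subseteq> period_lattice \<tau> 1"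
proof
  fix w assume "w \<in> period_lattice \<tau> k"
  then obtain m n where "w = of_nat k * (of_int m + of_int n * \<tau>)"
    by (rule period_latticeE)
  then have "w = of_nat 1 * (of_int (int k * m) + of_int (int k * n) * \<tau>)"
    by (simp add: algebra_simps)
  then show "w \<in> period_lattice \<tau> 1"
    by (simp only: period_latticeI)
qed

lemma period_lattice_divide_iff:
  assumes "k > 0"
  shows "z / of_nat k \<in> period_lattice \<tau> 1 \<longleftrightarrow> z \<in> period_lattice \<tau> k"
  using assms by (auto simp: period_lattice_def field_simps)

text \<open>Compactness of the torus: in the real basis 1, \<tau> of the plane, both coordinates of
  \<open>z / k\<close> are reduced to their fractional parts.\<close>

lemma bounded_reps:
  assumes "Im \<tau> > 0" "k > 0"
  shows "\<exists>w\<in>period_lattice \<tau> k. norm (z - w) \<le> of_nat k * (1 + norm \<tau>)"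
proof -
  define y where "y = Im (z / of_nat k) / Im \<tau>"
  define x where "x = Re (z / of_nat k) - y * Re \<tau>"
  have "z / of_nat k = of_real x + of_real y * \<tau>"
    using assms by (simp add: complex_eq_iff x_def y_def)
  then have z: "z = of_nat k * (of_real x + of_real y * \<tau>)"
    using assms by (simp add: field_simps)
  define w where "w = of_nat k * (of_int \<lfloor>x\<rfloor> + of_int \<lfloor>y\<rfloor> * \<tau>)"
  have "z - w = of_nat k * (of_real (frac x) + of_real (frac y) * \<tau>)"
    by (simp add: z w_def frac_def algebra_simps)
  moreover have "norm (of_real (frac x) + of_real (frac y) * \<tau>) \<le> 1 + norm \<tau>"
  proof (rule order_trans [OF norm_triangle_ineq add_mono])
    show "norm (of_real (frac x) :: complex) \<le> 1"
      by (simp add: less_imp_le frac_lt_1)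
    show "norm (of_real (frac y) * \<tau>) \<le> norm \<tau>"
      by (simp add: norm_mult mult_left_le_one_le less_imp_le frac_lt_1)
  qed
  ultimately have "norm (z - w) \<le> of_nat k * (1 + norm \<tau>)"
    by (simp add: norm_mult mult_left_mono)
  then show ?thesis
    using period_latticeI w_def by blast
qed

section \<open>Periodic functions and Liouville's theorem\<close>

lemma periodic_of_int:
  fixes f :: "complex \<Rightarrow> 'a"
  assumes "\<And>z. f (z + p) = f z"
  shows "f (z + of_int m * p) = f z"
proof -
  interpret periodic_fun_simple f p
    by standard (rule assms)
  show ?thesis by (rule plus_of_int)
qed

text \<open>The codomain is arbitrary so that predicates such as
  \<open>\<lambda>z. theta \<tau> z = 0\<close> are covered too.\<close>

lemma periodic_lattice:
  fixes f :: "complex \<Rightarrow> 'a"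
  assumes "\<And>z. f (z + of_nat k) = f z" "\<And>z. f (z + of_nat k * \<tau>) = f z" "w \<in> period_lattice \<tau> k"
  shows "f (z + w) = f z"
proof -
  obtain m n where w: "w = of_nat k * (of_int m + of_int n * \<tau>)"
    using assms(3) by (rule period_latticeE)
  have "f (z + w) = f (z + of_int m * of_nat k + of_int n * (of_nat k * \<tau>))"
    by (simp add: w algebra_simps)
  also have "\<dots> = f z"
    by (simp only: periodic_of_int [of f, OF assms(1)] periodic_of_int [of f, OF assms(2)])
  finally show ?thesis .
qed

text \<open>By \<open>bounded_reps\<close> all values are taken on one closed disc, so the function
  is bounded and Liouville's theorem applies.\<close>

lemma elliptic_entire_constant:
  assumes "Im \<tau> > 0" "k > 0" "f holomorphic_on UNIV"
    and "\<And>z. f (z + of_nat k) = f z" "\<And>z. f (z + of_nat k * \<tau>) = f z"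
  obtains c where "\<And>z. f z = c"
proof -
  define R where "R = of_nat k * (1 + norm \<tau>)"
  have "f z \<in> f ` cball 0 R" for z
  proof -
    obtain w where w: "w \<in> period_lattice \<tau> k" "norm (z - w) \<le> R"
      using bounded_reps [OF assms(1,2), of z] by (auto simp: R_def)
    have "f z = f (z - w)"
      using periodic_lattice [of f k \<tau> w "z - w"] assms(4,5) w(1) by simp
    with w(2) show ?thesis by auto
  qed
  then have "range f \<subseteq> f ` cball 0 R"
    by blast
  moreover have "bounded (f ` cball 0 R)"
    using assms(3) by (intro compact_imp_bounded compact_continuous_image)
      (auto intro: holomorphic_on_imp_continuous_on holomorphic_on_subset)
  ultimately have "bounded (range f)"
    by (rule bounded_subset [rotated])
  with Liouville_theorem [OF assms(3)] that show ?thesis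
    by (auto simp: constant_on_def)
qed

text \<open>The derivative of \<open>f' / f\<close> is elliptic, so \<open>f' / f\<close> is affine and, being periodic,
  constant.\<close>

lemma nonvanishing_quasi_periodic:
  assumes \<tau>: "Im \<tau> > 0" and k: "k > 0" and hol: "f holomorphic_on UNIV" and nz: "\<And>z. f z \<noteq> 0"
    and per: "\<And>z. f (z + of_nat k) = f z"
    and quasi: "\<And>z. f (z + of_nat k * \<tau>) = exp (\<alpha> * z + \<beta>) * f z"
  obtains n :: int where "\<alpha> = 0" "\<And>z. f z = f 0 * exp (2 * \<i> * of_real pi * of_int n * z / of_nat k)"
proof -
  let ?l = "\<lambda>z. deriv f z / f z"
  have D: "(f has_field_derivative deriv f z) (at z)" for z
    using hol by (simp add: holomorphic_derivI)
  have hl: "?l holomorphic_on UNIV"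
    using hol nz by (intro holomorphic_intros) auto
  have per_l: "?l (z + of_nat k) = ?l z" for z
  proof -
    have "((\<lambda>z. f (z + of_nat k)) has_field_derivative deriv f (z + of_nat k)) (at z)"
      using D [of "z + of_nat k"] by (subst (asm) DERIV_shift)
    then have "(f has_field_derivative deriv f (z + of_nat k)) (at z)"
      by (simp add: per)
    then show ?thesis
      using DERIV_unique [OF _ D] per by metis
  qed
  have quasi_l: "?l (z + of_nat k * \<tau>) = ?l z + \<alpha>" for z
  proof -
    have "((\<lambda>z. f (z + of_nat k * \<tau>)) has_field_derivative deriv f (z + of_nat k * \<tau>)) (at z)"
      using D [of "z + of_nat k * \<tau>"] by (subst (asm) DERIV_shift)
    moreover have "((\<lambda>z. f (z + of_nat k * \<tau>)) has_field_derivative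
        exp (\<alpha> * z + \<beta>) * (deriv f z + \<alpha> * f z)) (at z)"
      unfolding quasi by (rule derivative_eq_intros D refl)+ (simp add: algebra_simps)
    ultimately have "deriv f (z + of_nat k * \<tau>) = exp (\<alpha> * z + \<beta>) * (deriv f z + \<alpha> * f z)"
      by (rule DERIV_unique)
    then have "?l (z + of_nat k * \<tau>) = (deriv f z + \<alpha> * f z) / f z"
      by (simp add: quasi)
    then show ?thesis
      using nz [of z] by (simp add: add_divide_distrib)
  qed
  have Dl: "(?l has_field_derivative deriv ?l z) (at z)" for z
    using hl by (simp add: holomorphic_derivI)
  \<comment> \<open>The additive constant \<open>a\<close> serves both periods: it is 0 for
    \<open>k\<close> and \<alpha> for \<open>k \<tau>\<close>, and differentiation removes
    it.\<close>
  have shift_dl: "deriv ?l (z + w) = deriv ?l z" if "\<And>z. ?l (z + w) = ?l z + a" for z w a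
  proof -
    have "((\<lambda>z. ?l (z + w)) has_field_derivative deriv ?l (z + w)) (at z)"
      using Dl [of "z + w"] by (subst (asm) DERIV_shift)
    moreover have "((\<lambda>z. ?l z + a) has_field_derivative deriv ?l z) (at z)"
      using DERIV_add [OF Dl [of z] DERIV_const [of a]] by simp
    ultimately show ?thesis
      unfolding that by (rule DERIV_unique)
  qed
  obtain c where c: "\<And>z. deriv ?l z = c"
  proof (rule elliptic_entire_constant [OF \<tau> k, of "deriv ?l"])
    show "deriv ?l holomorphic_on UNIV"
      using hl by (rule holomorphic_deriv) auto
    show "deriv ?l (z + of_nat k) = deriv ?l z" for z
      by (rule shift_dl [where a = 0]) (simp only: per_l add_0_right)
    show "deriv ?l (z + of_nat k * \<tau>) = deriv ?l z" for z
      by (rule shift_dl [where a = \<alpha>]) (rule quasi_l)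
  qed blast
  obtain B where B: "\<And>z. ?l z - c * z = B"
  proof -
    have "((\<lambda>z. ?l z - c * z) has_field_derivative 0) (at z)" for z
      using DERIV_diff [OF Dl [of z, unfolded c] DERIV_cmult_Id [of c]] by simp
    then have "\<exists>B. \<forall>z. ?l z - c * z = B"
      using has_field_derivative_zero_constant [of UNIV "\<lambda>z. ?l z - c * z"] by auto
    with that show ?thesis by blast
  qed
  have l: "?l z = c * z + B" for z
    using B [of z] by (simp add: algebra_simps)
  have "c * of_nat k = 0"
    using per_l [of 0] unfolding l by simp
  with k have "c = 0"
    by simp
  then have dB: "deriv f z = B * f z" for z
    using l [of z] nz [of z] by (simp add: field_simps)
  have "\<alpha> = 0"
    using quasi_l [of 0] unfolding l \<open>c = 0\<close> by simp
  have "((\<lambda>z. f z * exp (- B * z)) has_field_derivative 0) (at z)" for z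
    using D [of z] unfolding dB by (auto intro!: derivative_eq_intros)
  then have "\<exists>C. \<forall>z. f z * exp (- B * z) = C"
    using has_field_derivative_zero_constant [of UNIV "\<lambda>z. f z * exp (- B * z)"] by auto
  then obtain C where C: "\<And>z. f z * exp (- B * z) = C"
    by blast
  have f: "f z = f 0 * exp (B * z)" for z
    using C [of z] C [of 0] by (simp add: exp_minus field_simps)
  \<comment> \<open>The period \<open>k\<close> of \<open>f\<close> forces \<open>B k\<close> to be
    an integer multiple of 2 pi i; the integer is \<open>n\<close>.\<close>
  have "exp (B * of_nat k) = exp 0"
    using per [of 0] f [of "of_nat k"] nz [of 0] by simp
  then obtain n :: int where n: "B * of_nat k = of_real (of_int (2 * n) * pi) * \<i>"
    unfolding exp_eq by auto
  then have "B = 2 * \<i> * of_real pi * of_int n / of_nat k"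
    using k by (simp add: field_simps)
  then have "f z = f 0 * exp (2 * \<i> * of_real pi * of_int n * z / of_nat k)" for z
    using f [of z] by simp
  with that \<open>\<alpha> = 0\<close> show ?thesis by blast
qed

section \<open>The zeros of the theta function\<close>

definition theta_coeff :: "complex \<Rightarrow> nat \<Rightarrow> complex" where
  "theta_coeff \<tau> j = (-1) ^ j * exp (\<i> * of_real pi * of_int (int j * (int j - 1)) * \<tau>)"

definition theta_term :: "complex \<Rightarrow> complex \<Rightarrow> int \<Rightarrow> complex" where
  "theta_term \<tau> z m = (-1) powi m * exp (\<i> * of_real pi * of_int (m * (m - 1)) * \<tau>)
     * exp (2 * \<i> * of_real pi * of_int m * z)"

lemma theta_eq_infsum: "theta \<tau> z = infsum (theta_term \<tau> z) UNIV"
  unfolding theta_def theta_term_def by simp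

lemma exp_of_int_mult: "exp (2 * \<i> * of_real pi * of_int m * z) = exp (2 * \<i> * of_real pi * z) powi m"
  by (simp add: exp_power_int mult_ac)

lemma norm_exp_tau_less_1: "Im \<tau> > 0 \<Longrightarrow> norm (exp (2 * \<i> * of_real pi * \<tau>)) < 1"
  by simp

lemma theta_coeff_Suc:
  "theta_coeff \<tau> (Suc j) = - (exp (2 * \<i> * of_real pi * \<tau>) ^ j * theta_coeff \<tau> j)"
proof -
  have "exp (\<i> * of_real pi * of_int (int (Suc j) * (int (Suc j) - 1)) * \<tau>) =
        exp (of_nat j * (2 * \<i> * of_real pi * \<tau>)) *
        exp (\<i> * of_real pi * of_int (int j * (int j - 1)) * \<tau>)"
    unfolding exp_add [symmetric] by (rule arg_cong [where f = exp]) (simp add: algebra_simps)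
  then show ?thesis
    by (simp add: theta_coeff_def exp_of_nat_mult)
qed

text \<open>With \<open>q = exp (2 pi i \<tau>)\<close>, consecutive terms have ratio
  \<open>- q ^ j * x\<close>, which tends to 0 because |q| < 1; the radius of convergence is
  infinite.\<close>

lemma summable_theta_coeff:
  assumes "Im \<tau> > 0"
  shows "summable (\<lambda>j. norm (theta_coeff \<tau> j * x ^ j))"
proof -
  define q where "q = norm (exp (2 * \<i> * of_real pi * \<tau>))"
  have q: "0 \<le> q" "q < 1"
    using norm_exp_tau_less_1 [OF assms] by (auto simp: q_def)
  have "(\<lambda>j. q ^ j * norm x) \<longlonglongrightarrow> 0 * norm x"
    by (intro tendsto_mult tendsto_const LIMSEQ_power_zero) (use q in auto)
  then have "\<forall>\<^sub>F j in sequentially. q ^ j * norm x < 1 / 2"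
    by (rule order_tendstoD) auto
  then obtain N where N: "\<And>j. j \<ge> N \<Longrightarrow> q ^ j * norm x < 1 / 2"
    by (auto simp: eventually_sequentially)
  show ?thesis
  proof (rule summable_ratio_test [of "1/2" N])
    fix j assume "j \<ge> N"
    have "norm (theta_coeff \<tau> (Suc j) * x ^ Suc j) =
        (q ^ j * norm x) * norm (theta_coeff \<tau> j * x ^ j)"
      by (simp add: theta_coeff_Suc norm_mult norm_power q_def del: norm_exp_eq_Re)
    also have "\<dots> \<le> 1 / 2 * norm (theta_coeff \<tau> j * x ^ j)"
      using N [OF \<open>j \<ge> N\<close>] by (intro mult_right_mono) auto
    finally show "norm (norm (theta_coeff \<tau> (Suc j) * x ^ Suc j)) \<le>
        1 / 2 * norm (norm (theta_coeff \<tau> j * x ^ j))"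
      by simp
  qed simp
qed

lemma summable_norm_powser_shift:
  fixes x :: complex
  assumes "\<And>x. summable (\<lambda>j. norm (c j * x ^ j))"
  shows "summable (\<lambda>j. norm (c (Suc j) * x ^ j))"
proof (cases "x = 0")
  case True
  then show ?thesis
    by (intro summable_finite [of "{0}"]) auto
next
  case False
  have "summable (\<lambda>j. norm (c (Suc j) * x ^ Suc j))"
    using assms [of x] by (subst summable_Suc_iff)
  then have "summable (\<lambda>j. inverse (norm x) * norm (c (Suc j) * x ^ Suc j))"
    by (rule summable_mult)
  moreover have "inverse (norm x) * norm (c (Suc j) * x ^ Suc j) = norm (c (Suc j) * x ^ j)" for j
    using False by (simp add: norm_mult field_simps)
  ultimately show ?thesis by (simp only:)
qed

lemma holomorphic_power_series:
  assumes "\<And>x. summable (\<lambda>j. norm (c j * x ^ j))"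
  shows "(\<lambda>x::complex. \<Sum>j. c j * x ^ j) holomorphic_on UNIV"
proof -
  have "summable (\<lambda>j. c j * x ^ j)" for x
    using assms by (rule summable_norm_cancel)
  then have "((\<lambda>x. \<Sum>j. c j * x ^ j) has_field_derivative (\<Sum>j. diffs c j * x ^ j)) (at x)" for x
    by (rule termdiffs_strong_converges_everywhere)
  then show ?thesis
    by (auto simp: holomorphic_on_def field_differentiable_def intro: has_field_derivative_at_within)
qed

definition theta_pos :: "complex \<Rightarrow> complex \<Rightarrow> complex" where
  "theta_pos \<tau> w = (\<Sum>j. theta_coeff \<tau> j * w ^ j)"

text \<open>The part with negative indices, as a function of \<open>1 / w\<close>. The indices
  \<open>m = - (j + 1)\<close> and \<open>1 - m = j + 2\<close> give the same
  \<open>m (m - 1)\<close> and opposite signs, hence the shift by 2 and the minus sign.\<close>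

definition theta_neg :: "complex \<Rightarrow> complex \<Rightarrow> complex" where
  "theta_neg \<tau> w = - w * (\<Sum>j. theta_coeff \<tau> (Suc (Suc j)) * w ^ j)"

lemma summable_theta_neg:
  "Im \<tau> > 0 \<Longrightarrow> summable (\<lambda>j. norm (theta_coeff \<tau> (Suc (Suc j)) * x ^ j))"
  by (rule summable_norm_powser_shift)+ (rule summable_theta_coeff)

lemma holomorphic_theta_pos: "Im \<tau> > 0 \<Longrightarrow> theta_pos \<tau> holomorphic_on UNIV"
  unfolding theta_pos_def [abs_def] by (intro holomorphic_power_series summable_theta_coeff)

lemma holomorphic_theta_neg: "Im \<tau> > 0 \<Longrightarrow> theta_neg \<tau> holomorphic_on UNIV"
  unfolding theta_neg_def [abs_def]
  by (intro holomorphic_intros holomorphic_power_series summable_theta_neg)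

text \<open>The integers split into the numbers \<open>j\<close> and \<open>- (j + 1)\<close> with
  \<open>j\<close> natural; absolute convergence of both power series gives unconditional
  summability.\<close>

lemma theta_has_sum:
  assumes "Im \<tau> > 0"
  defines "w \<equiv> \<lambda>z. exp (2 * \<i> * of_real pi * z)"
  shows "(theta_term \<tau> z has_sum (theta_pos \<tau> (w z) + theta_neg \<tau> (inverse (w z)))) UNIV"
proof -
  have 1: "theta_term \<tau> z \<circ> int = (\<lambda>j. theta_coeff \<tau> j * w z ^ j)"
    unfolding comp_def theta_term_def exp_of_int_mult by (simp add: w_def theta_coeff_def)
  have 2: "theta_term \<tau> z \<circ> (\<lambda>j. - int (Suc j)) =
      (\<lambda>j. - inverse (w z) * (theta_coeff \<tau> (Suc (Suc j)) * inverse (w z) ^ j))"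
  proof
    fix j
    have "(- 1 :: complex) powi (- int (Suc j)) = - ((- 1) ^ Suc (Suc j))"
      unfolding power_int_minus power_int_of_nat by (simp flip: power_inverse)
    moreover have "- int (Suc j) * (- int (Suc j) - 1) = int (Suc (Suc j)) * (int (Suc (Suc j)) - 1)"
      by (simp add: algebra_simps)
    moreover have "w z powi (- int (Suc j)) = inverse (w z) * inverse (w z) ^ j"
      unfolding power_int_minus power_int_of_nat by (simp flip: power_inverse)
    ultimately show "(theta_term \<tau> z \<circ> (\<lambda>j. - int (Suc j))) j =
        - inverse (w z) * (theta_coeff \<tau> (Suc (Suc j)) * inverse (w z) ^ j)"
      unfolding comp_def theta_term_def theta_coeff_def exp_of_int_mult w_def
      by (simp only: mult_minus_left mult_minus_right mult_ac)
  qed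
  note sum1 = summable_theta_coeff [OF assms(1), of "w z"]
  note sum2 = summable_theta_neg [OF assms(1), of "inverse (w z)"]
  have "((\<lambda>j. theta_coeff \<tau> j * w z ^ j) has_sum theta_pos \<tau> (w z)) UNIV"
    unfolding theta_pos_def
    by (rule norm_summable_imp_has_sum [OF sum1 summable_sums [OF summable_norm_cancel [OF sum1]]])
  then have A: "(theta_term \<tau> z has_sum theta_pos \<tau> (w z)) (range int)"
    by (subst has_sum_reindex) (auto simp: 1)
  have "((\<lambda>j. theta_coeff \<tau> (Suc (Suc j)) * inverse (w z) ^ j) has_sum
      (\<Sum>j. theta_coeff \<tau> (Suc (Suc j)) * inverse (w z) ^ j)) UNIV"
    by (rule norm_summable_imp_has_sum [OF sum2 summable_sums [OF summable_norm_cancel [OF sum2]]])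
  then have "((theta_term \<tau> z \<circ> (\<lambda>j. - int (Suc j))) has_sum theta_neg \<tau> (inverse (w z))) UNIV"
    unfolding 2 theta_neg_def by (rule has_sum_cmult_right)
  then have B: "(theta_term \<tau> z has_sum theta_neg \<tau> (inverse (w z))) (range (\<lambda>j. - int (Suc j)))"
    by (subst has_sum_reindex) (auto simp: inj_def)
  have "x \<in> range int \<union> range (\<lambda>j. - int (Suc j))" for x
    by (cases x rule: int_cases) auto
  then have "range int \<union> range (\<lambda>j. - int (Suc j)) = UNIV"
    by blast
  moreover have "range int \<inter> range (\<lambda>j. - int (Suc j)) = {}"
    by auto
  ultimately show ?thesis
    using has_sum_Un_disjoint [OF A B] by simp
qed

lemma theta_laurent:
  assumes "Im \<tau> > 0"
  shows "theta \<tau> z = theta_pos \<tau> (exp (2 * \<i> * of_real pi * z)) +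
    theta_neg \<tau> (inverse (exp (2 * \<i> * of_real pi * z)))"
  using theta_has_sum [OF assms] by (simp add: theta_eq_infsum infsumI)

lemma holomorphic_theta:
  assumes "Im \<tau> > 0"
  shows "theta \<tau> holomorphic_on UNIV"
proof -
  have "(\<lambda>z. (theta_pos \<tau> \<circ> (\<lambda>z. exp (2 * \<i> * of_real pi * z))) z +
      (theta_neg \<tau> \<circ> (\<lambda>z. inverse (exp (2 * \<i> * of_real pi * z)))) z) holomorphic_on UNIV"
    by (intro holomorphic_intros holomorphic_on_compose_gen [OF _ holomorphic_theta_pos [OF assms]]
        holomorphic_on_compose_gen [OF _ holomorphic_theta_neg [OF assms]]) auto
  then show ?thesis
    using theta_laurent [OF assms] by (simp add: o_def cong: holomorphic_cong)
qed

section \<open>Quasi-periodicity of theta and its zero at the origin\<close>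

lemma theta_plus_1: "theta \<tau> (z + 1) = theta \<tau> z"
proof -
  have "2 * \<i> * of_real pi * (z + 1) = 2 * \<i> * of_real pi * z + 2 * of_real pi * \<i>"
    by (simp add: algebra_simps)
  then have "exp (2 * \<i> * of_real pi * (z + 1)) = exp (2 * \<i> * of_real pi * z)"
    by (simp only: exp_add exp_two_pi_i mult_1_right)
  then show ?thesis
    unfolding theta_def exp_of_int_mult by simp
qed

lemma theta_plus_tau:
  "theta \<tau> (z + \<tau>) = - exp (- 2 * \<i> * of_real pi * z) * theta \<tau> z"
proof -
  \<comment> \<open>Since \<open>m (m - 1) + 2 m = (m + 1) m\<close>, translation by \<tau> moves
    each term to the next index, up to sign and a common factor.\<close>
  have *: "theta_term \<tau> (z + \<tau>) m =
      - exp (- 2 * \<i> * of_real pi * z) * theta_term \<tau> z (m + 1)" for m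
  proof -
    have "exp (\<i> * of_real pi * of_int (m * (m - 1)) * \<tau>) *
        exp (2 * \<i> * of_real pi * of_int m * (z + \<tau>)) =
        exp (- 2 * \<i> * of_real pi * z) * (exp (\<i> * of_real pi * of_int ((m + 1) * (m + 1 - 1)) * \<tau>) *
        exp (2 * \<i> * of_real pi * of_int (m + 1) * z))"
      unfolding exp_add [symmetric] by (rule arg_cong [where f = exp]) (simp add: algebra_simps)
    then show ?thesis
      unfolding theta_term_def by (simp add: power_int_add mult_ac)
  qed
  have "theta \<tau> (z + \<tau>) =
      - exp (- 2 * \<i> * of_real pi * z) * infsum (\<lambda>m. theta_term \<tau> z (m + 1)) UNIV"
    unfolding theta_eq_infsum * by (rule infsum_cmult_right')
  also have "infsum (\<lambda>m. theta_term \<tau> z (m + 1)) UNIV = infsum (theta_term \<tau> z) UNIV"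
    by (rule infsum_reindex_bij_witness [of _ "\<lambda>m. m - 1" "\<lambda>m. m + 1"]) auto
  finally show ?thesis
    by (simp add: theta_eq_infsum)
qed

lemma theta_0: "theta \<tau> 0 = 0"
proof -
  \<comment> \<open>The involution \<open>m \<mapsto> 1 - m\<close> preserves
    \<open>m (m - 1)\<close> and reverses the sign, so the series equals its own negative.\<close>
  have *: "theta_term \<tau> 0 (1 - m) = - theta_term \<tau> 0 m" for m
  proof -
    have "(- 1 :: complex) powi (1 - m) = - ((- 1) powi m)"
      by (simp add: power_int_diff power_int_minus_left)
    moreover have "(1 - m) * (1 - m - 1) = m * (m - 1)"
      by (simp add: algebra_simps)
    ultimately show ?thesis
      by (simp add: theta_term_def)
  qed
  have "theta \<tau> 0 = infsum (\<lambda>m. theta_term \<tau> 0 (1 - m)) UNIV"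
    unfolding theta_eq_infsum
    by (rule infsum_reindex_bij_witness [of _ "\<lambda>m. 1 - m" "\<lambda>m. 1 - m"]) auto
  also have "\<dots> = - theta \<tau> 0"
    unfolding * by (simp add: theta_eq_infsum infsum_uminus)
  finally show ?thesis
    by simp
qed

text \<open>If \<^term>\<open>theta \<tau>\<close> vanished, the nonnegative part of the Laurent series in \<open>exp (2 \<pi> \<i> z)\<close>
  would be an entire function vanishing at infinity.\<close>

lemma theta_nonzero:
  assumes "Im \<tau> > 0"
  obtains z where "theta \<tau> z \<noteq> 0"
proof -
  have "\<exists>z. theta \<tau> z \<noteq> 0"
  proof (rule ccontr)
    assume "\<nexists>z. theta \<tau> z \<noteq> 0"
    then have zero: "theta \<tau> z = 0" for z by blast
    have eq: "theta_pos \<tau> w = - theta_neg \<tau> (inverse w)" if "w \<noteq> 0" for w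
    proof -
      \<comment> \<open>A logarithm shows that \<open>exp (2 pi i z)\<close> takes every nonzero
        value \<open>w\<close>.\<close>
      define z where "z = Ln w / (2 * \<i> * of_real pi)"
      have "exp (2 * \<i> * of_real pi * z) = w"
        using that by (simp add: z_def)
      with theta_laurent [OF assms, of z] zero [of z] show ?thesis
        by (simp add: eq_neg_iff_add_eq_0)
    qed
    have "isCont (theta_neg \<tau>) 0"
      using holomorphic_theta_neg [OF assms]
      by (meson UNIV_I continuous_on_eq_continuous_at holomorphic_on_imp_continuous_on open_UNIV)
    then have "((\<lambda>w. theta_neg \<tau> (inverse w)) \<longlongrightarrow> theta_neg \<tau> 0) at_infinity"
      by (rule isCont_tendsto_compose) (rule tendsto_inverse_0)
    then have "((\<lambda>w. - theta_neg \<tau> (inverse w)) \<longlongrightarrow> - theta_neg \<tau> 0) at_infinity"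
      by (rule tendsto_minus)
    moreover have "theta_neg \<tau> 0 = 0"
      by (simp add: theta_neg_def)
    ultimately have "((\<lambda>w. - theta_neg \<tau> (inverse w)) \<longlongrightarrow> 0) at_infinity"
      by simp
    then have "(theta_pos \<tau> \<longlongrightarrow> 0) at_infinity"
    proof (rule Lim_transform_eventually)
      have "- theta_neg \<tau> (inverse w) = theta_pos \<tau> w" if "1 \<le> norm w" for w
        using that eq [of w] by force
      then show "\<forall>\<^sub>F w in at_infinity. - theta_neg \<tau> (inverse w) = theta_pos \<tau> w"
        unfolding eventually_at_infinity by blast
    qed
    then have "theta_pos \<tau> 0 = 0"
      by (rule Liouville_weak_0 [OF holomorphic_theta_pos [OF assms]])
    moreover have "theta_pos \<tau> 0 = 1"
      by (simp add: theta_pos_def powser_zero theta_coeff_def)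
    ultimately show False by simp
  qed
  with that show ?thesis by blast
qed

section \<open>The infinite q-Pochhammer product (w; q)\<close>

definition qprod :: "complex \<Rightarrow> complex \<Rightarrow> complex" where
  "qprod q w = (\<Prod>n. 1 - q ^ n * w)"

lemma convergent_qprod:
  fixes q w :: complex
  assumes "norm q < 1"
  shows "convergent_prod (\<lambda>n. 1 - q ^ n * w)"
proof -
  have "summable (\<lambda>n. norm q ^ n * norm w)"
    using assms by (intro summable_mult2 summable_geometric) auto
  then have "summable (\<lambda>n. norm (1 - q ^ n * w - 1))"
    by (simp add: norm_mult norm_power)
  then have "abs_convergent_prod (\<lambda>n. 1 - q ^ n * w)"
    by (rule summable_imp_abs_convergent_prod)
  then show ?thesis
    by (rule abs_convergent_prod_imp_convergent_prod)
qed

text \<open>Geometric domination on the disc of radius 1 about each point makes the partial products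
  converge locally uniformly.\<close>

lemma holomorphic_qprod:
  assumes "norm q < 1"
  shows "qprod q holomorphic_on UNIV"
proof (rule holomorphic_uniform_sequence)
  fix x :: complex
  let ?f = "\<lambda>n w. 1 - q ^ n * w"
  have "uniformly_convergent_on (cball x 1) (\<lambda>N w. \<Prod>n<N. ?f n w)"
  proof (rule uniformly_convergent_on_prod')
    show "uniformly_convergent_on (cball x 1) (\<lambda>N w. \<Sum>n<N. norm (?f n w - 1))"
    proof (rule Weierstrass_m_test')
      fix n w assume w: "w \<in> cball x 1"
      have "norm w \<le> norm x + 1"
        using w norm_triangle_ineq2 [of w x] by (auto simp: dist_norm norm_minus_commute)
      then show "norm (norm (?f n w - 1)) \<le> norm q ^ n * (norm x + 1)"
        by (simp add: norm_mult norm_power mult_left_mono)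
    next
      show "summable (\<lambda>n. norm q ^ n * (norm x + 1))"
        using assms by (intro summable_mult2 summable_geometric) auto
    qed
  qed (auto intro!: continuous_intros)
  then have "uniform_limit (cball x 1) (\<lambda>N w. \<Prod>n<N. ?f n w) (\<lambda>w. lim (\<lambda>N. \<Prod>n<N. ?f n w)) sequentially"
    by (simp add: uniformly_convergent_uniform_limit_iff)
  moreover have "lim (\<lambda>N. \<Prod>n<N. ?f n w) = qprod q w" for w
  proof -
    have "(\<lambda>N. \<Prod>n\<le>N. ?f n w) \<longlonglongrightarrow> qprod q w"
      unfolding qprod_def by (rule convergent_prod_LIMSEQ [OF convergent_qprod [OF assms]])
    then have "(\<lambda>N. \<Prod>n<Suc N. ?f n w) \<longlonglongrightarrow> qprod q w"
      by (simp only: lessThan_Suc_atMost)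
    then have "(\<lambda>N. \<Prod>n<N. ?f n w) \<longlonglongrightarrow> qprod q w"
      by (subst (asm) filterlim_sequentially_Suc)
    then show ?thesis by (rule limI)
  qed
  ultimately have "uniform_limit (cball x 1) (\<lambda>N w. \<Prod>n<N. ?f n w) (qprod q) sequentially"
    by simp
  then show "\<exists>d>0. cball x d \<subseteq> UNIV \<and> uniform_limit (cball x d) (\<lambda>N w. \<Prod>n<N. ?f n w) (qprod q) sequentially"
    by (intro exI [of _ 1]) auto
qed (auto intro!: holomorphic_intros)

lemma qprod_rec:
  assumes "norm q < 1"
  shows "qprod q w = (1 - w) * qprod q (q * w)"
proof -
  have "(\<lambda>n. 1 - q ^ n * w) has_prod ((\<Prod>n<1. 1 - q ^ n * w) * (\<Prod>n. 1 - q ^ (n + 1) * w))"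
    by (rule has_prod_ignore_initial_segment' [OF convergent_qprod [OF assms]])
  then show ?thesis
    unfolding qprod_def by (auto simp: mult_ac dest: has_prod_unique)
qed

text \<open>No factor vanishes because |q^n w| < 1, and a convergent infinite product of nonzero
  factors is nonzero.\<close>

lemma qprod_nonzero:
  assumes "norm q < 1" "norm w < 1"
  shows "qprod q w \<noteq> 0"
  unfolding qprod_def
proof (rule prodinf_nonzero [OF convergent_qprod [OF assms(1)]])
  fix n
  have "norm (q ^ n * w) \<le> 1 * norm w"
    using assms unfolding norm_mult norm_power by (intro mult_right_mono power_le_one) auto
  with assms(2) show "1 - q ^ n * w \<noteq> 0"
    by auto
qed

text \<open>With \<open>w = exp (2 pi i z)\<close> and \<open>q = exp (2 pi i \<tau>)\<close> this
  is (w; q) times (q / w; q): the triple product of Jacobi for \<open>theta\<close>, up to a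
  constant factor.\<close>

definition theta_prod :: "complex \<Rightarrow> complex \<Rightarrow> complex" where
  "theta_prod \<tau> z = qprod (exp (2 * \<i> * of_real pi * \<tau>)) (exp (2 * \<i> * of_real pi * z)) *
     qprod (exp (2 * \<i> * of_real pi * \<tau>)) (exp (2 * \<i> * of_real pi * (\<tau> - z)))"

lemma exp_2pii_plus_1: "exp (2 * \<i> * of_real pi * (z + 1)) = exp (2 * \<i> * of_real pi * z)"
  and exp_2pii_minus_1: "exp (2 * \<i> * of_real pi * (z - 1)) = exp (2 * \<i> * of_real pi * z)"
  using exp_two_pi_i by (simp_all add: exp_add exp_diff distrib_left right_diff_distrib mult_ac)

lemma theta_prod_plus_1: "theta_prod \<tau> (z + 1) = theta_prod \<tau> z"
  using exp_2pii_plus_1 [of z] exp_2pii_minus_1 [of "\<tau> - z"] by (simp add: theta_prod_def diff_diff_eq)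

text \<open>Splitting off \<open>1 - w\<close> isolates the zeros in the strip |Im z| < Im \<tau>:
  there \<open>q w\<close> and \<open>q / w\<close> have modulus below 1, so the cofactor does not
  vanish.\<close>

lemma theta_prod_factor:
  assumes "Im \<tau> > 0"
  shows "theta_prod \<tau> z = (1 - exp (2 * \<i> * of_real pi * z)) *
    (qprod (exp (2 * \<i> * of_real pi * \<tau>)) (exp (2 * \<i> * of_real pi * (\<tau> + z))) *
     qprod (exp (2 * \<i> * of_real pi * \<tau>)) (exp (2 * \<i> * of_real pi * (\<tau> - z))))"
  using qprod_rec [OF norm_exp_tau_less_1 [OF assms], of "exp (2 * \<i> * of_real pi * z)"]
  by (simp add: theta_prod_def distrib_left exp_add mult.assoc)

text \<open>Translation sends \<open>w\<close> to \<open>q w\<close> and \<open>q / w\<close> to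
  \<open>1 / w\<close>. The recursion of \<open>qprod\<close> and
  \<open>1 - 1 / w = - (1 - w) / w\<close> give the same multiplier as for
  \<open>theta\<close>.\<close>

lemma theta_prod_plus_tau:
  assumes "Im \<tau> > 0"
  shows "theta_prod \<tau> (z + \<tau>) = - exp (- 2 * \<i> * of_real pi * z) * theta_prod \<tau> z"
proof -
  let ?w = "exp (2 * \<i> * of_real pi * z)" and ?G = "qprod (exp (2 * \<i> * of_real pi * \<tau>))"
  let ?v = "exp (- 2 * \<i> * of_real pi * z)"
  have wv: "?w * ?v = 1"
    by (simp flip: exp_add)
  have "?G ?v = (1 - ?v) * ?G (exp (2 * \<i> * of_real pi * (\<tau> - z)))"
    using qprod_rec [OF norm_exp_tau_less_1 [OF assms], of ?v]
    by (simp add: right_diff_distrib exp_diff exp_minus field_simps)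
  moreover have "theta_prod \<tau> (z + \<tau>) = ?G (exp (2 * \<i> * of_real pi * (\<tau> + z))) * ?G ?v"
    by (simp add: theta_prod_def add.commute)
  moreover have "1 - ?v = - ?v * (1 - ?w)"
    using wv by (simp add: algebra_simps)
  ultimately show ?thesis
    unfolding theta_prod_factor [OF assms, of z] by (simp only: mult_ac)
qed

lemma holomorphic_theta_prod:
  assumes "Im \<tau> > 0"
  shows "theta_prod \<tau> holomorphic_on UNIV"
proof -
  note qp = holomorphic_qprod [OF norm_exp_tau_less_1 [OF assms]]
  have "(\<lambda>z. (qprod (exp (2 * \<i> * of_real pi * \<tau>)) \<circ> (\<lambda>z. exp (2 * \<i> * of_real pi * z))) z *
     (qprod (exp (2 * \<i> * of_real pi * \<tau>)) \<circ> (\<lambda>z. exp (2 * \<i> * of_real pi * (\<tau> - z)))) z) holomorphic_on UNIV"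
    by (intro holomorphic_on_mult holomorphic_on_compose_gen [OF _ qp] holomorphic_intros) auto
  then show ?thesis
    by (simp add: o_def theta_prod_def [abs_def])
qed

lemma theta_prod_cofactor_nonzero:
  assumes "\<bar>Im z\<bar> < Im \<tau>"
  shows "qprod (exp (2 * \<i> * of_real pi * \<tau>)) (exp (2 * \<i> * of_real pi * (\<tau> + z))) *
     qprod (exp (2 * \<i> * of_real pi * \<tau>)) (exp (2 * \<i> * of_real pi * (\<tau> - z))) \<noteq> 0"
  using assms by (intro no_zero_divisors qprod_nonzero) (auto simp: abs_if split: if_splits)

lemma nz_theta_prod:
  assumes "Im \<tau> > 0"
  shows "nz_meromorphic (theta_prod \<tau>)"
proof (rule nz_meromorphic_holomorphic [OF holomorphic_theta_prod [OF assms]])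
  have "2 * \<i> * of_real pi * (1 / 2) = of_real pi * \<i>"
    by simp
  then have "exp (2 * \<i> * of_real pi * (1 / 2)) = - 1"
    by (simp only: exp_pi_i)
  then show "theta_prod \<tau> (1 / 2) \<noteq> 0"
    unfolding theta_prod_factor [OF assms]
    using theta_prod_cofactor_nonzero [of "1/2" \<tau>] assms by (simp del: mult_eq_0_iff)
qed

lemma exp_2pii_eq_1_iff: "exp (2 * \<i> * of_real pi * z) = 1 \<longleftrightarrow> z \<in> \<int>"
proof -
  have "exp (2 * \<i> * of_real pi * z) = exp 0 \<longleftrightarrow> (\<exists>n::int. z = of_int n)"
    unfolding exp_eq by (auto simp: field_simps)
  then show ?thesis
    by (simp add: Ints_def image_def)
qed

lemma zorder_theta_prod_strip:
  assumes "\<bar>Im z\<bar> < Im \<tau>"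
  shows "zorder (theta_prod \<tau>) z = (if z \<in> \<int> then 1 else 0)"
proof -
  have \<tau>: "Im \<tau> > 0"
    using assms by linarith
  let ?K = "\<lambda>z. qprod (exp (2 * \<i> * of_real pi * \<tau>)) (exp (2 * \<i> * of_real pi * (\<tau> + z))) *
     qprod (exp (2 * \<i> * of_real pi * \<tau>)) (exp (2 * \<i> * of_real pi * (\<tau> - z)))"
  let ?E = "\<lambda>z. 1 - exp (2 * \<i> * of_real pi * z)"
  note qp = holomorphic_qprod [OF norm_exp_tau_less_1 [OF \<tau>]]
  have "(\<lambda>z. (qprod (exp (2 * \<i> * of_real pi * \<tau>)) \<circ> (\<lambda>z. exp (2 * \<i> * of_real pi * (\<tau> + z)))) z *
     (qprod (exp (2 * \<i> * of_real pi * \<tau>)) \<circ> (\<lambda>z. exp (2 * \<i> * of_real pi * (\<tau> - z)))) z) holomorphic_on UNIV"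
    by (intro holomorphic_on_mult holomorphic_on_compose_gen [OF _ qp] holomorphic_intros) auto
  then have K: "?K holomorphic_on UNIV"
    by (simp add: o_def)
  have E: "?E holomorphic_on UNIV"
    by (intro holomorphic_intros)
  have "\<i> \<notin> \<int>"
    by (auto simp: Ints_def complex_eq_iff)
  then have nzE: "nz_meromorphic ?E"
    by (intro nz_meromorphic_holomorphic [OF E, of "\<i>"]) (simp add: exp_2pii_eq_1_iff)
  have nzK: "nz_meromorphic ?K"
    by (rule nz_meromorphic_holomorphic [OF K theta_prod_cofactor_nonzero [of 0]]) (use \<tau> in auto)
  have "zorder (theta_prod \<tau>) z = zorder (\<lambda>z. ?E z * ?K z) z"
    unfolding theta_prod_factor [OF \<tau>, abs_def] ..
  also have "\<dots> = zorder ?E z + zorder ?K z"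
    by (rule zorder_nz_mult [OF nzE nzK])
  also have "zorder ?K z = 0"
    using theta_prod_cofactor_nonzero [OF assms] by (rule zorder_entire_nonzero [OF K])
  also have "zorder ?E z = (if z \<in> \<int> then 1 else 0)"
  proof (cases "z \<in> \<int>")
    case True
    \<comment> \<open>The zeros of \<open>1 - w\<close> are simple because its derivative vanishes
      nowhere.\<close>
    have "deriv ?E z = - (2 * \<i> * of_real pi) * exp (2 * \<i> * of_real pi * z)"
      by (intro DERIV_imp_deriv) (auto intro!: derivative_eq_intros)
    then have "deriv ?E z \<noteq> 0"
      by simp
    then have "zorder ?E z = 1"
      using True by (intro zorder_zero_eqI [OF E]) (auto simp: exp_2pii_eq_1_iff)
    with True show ?thesis by simp
  next
    case False
    then show ?thesis
      using zorder_entire_nonzero [OF E, of z] by (simp add: exp_2pii_eq_1_iff)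
  qed
  finally show ?thesis by simp
qed

lemma zorder_theta_prod:
  assumes "Im \<tau> > 0"
  shows "zorder (theta_prod \<tau>) z = (if z \<in> period_lattice \<tau> 1 then 1 else 0)"
proof -
  \<comment> \<open>Translation by \<open>- n \<tau>\<close> brings \<open>z\<close> into the strip
    where the order is known, without changing the order.\<close>
  define n where "n = \<lfloor>Im z / Im \<tau>\<rfloor>"
  define z' where "z' = z + of_int (- n) * \<tau>"
  have "of_int n \<le> Im z / Im \<tau>" "Im z / Im \<tau> < of_int n + 1"
    unfolding n_def by linarith+
  then have "Im z' \<ge> 0" "Im z' < Im \<tau>"
    using assms by (auto simp: z'_def field_simps)
  then have "zorder (theta_prod \<tau>) z' = (if z' \<in> \<int> then 1 else 0)"
    by (intro zorder_theta_prod_strip) auto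
  moreover have "z' \<in> \<int> \<longleftrightarrow> z \<in> period_lattice \<tau> 1"
  proof
    assume "z' \<in> \<int>"
    then obtain m where "z' = of_int m"
      by (elim Ints_cases)
    then have "z = of_nat 1 * (of_int m + of_int n * \<tau>)"
      by (simp add: z'_def algebra_simps)
    then show "z \<in> period_lattice \<tau> 1"
      by (simp only: period_latticeI)
  next
    assume "z \<in> period_lattice \<tau> 1"
    then obtain m j where z: "z = of_nat 1 * (of_int m + of_int j * \<tau>)"
      by (rule period_latticeE)
    then have "Im z / Im \<tau> = of_int j"
      using assms by simp
    then have "n = j"
      by (simp add: n_def)
    with z have "z' = of_int m"
      by (simp add: z'_def)
    then show "z' \<in> \<int>" by simp
  qed
  moreover have "zorder (theta_prod \<tau>) z' = zorder (theta_prod \<tau>) z"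
    unfolding z'_def
  proof (rule periodic_of_int)
    fix z
    show "zorder (theta_prod \<tau>) (z + \<tau>) = zorder (theta_prod \<tau>) z"
      by (rule zorder_quasi_periodic [OF nz_theta_prod [OF assms] _ _ theta_prod_plus_tau [OF assms]])
         (auto intro!: holomorphic_intros)
  qed
  ultimately show ?thesis by simp
qed

section \<open>Comparison of theta with the product\<close>

lemma theta_lattice:
  assumes "z \<in> period_lattice \<tau> 1"
  shows "theta \<tau> z = 0"
proof -
  \<comment> \<open>Vanishing is a periodic predicate because the multipliers of
    \<open>theta\<close> have no zeros; the zero at 0 thus spreads over the lattice.\<close>
  have "(theta \<tau> (0 + z) = 0) = (theta \<tau> 0 = 0)"
    by (rule periodic_lattice [OF _ _ assms]) (simp_all add: theta_plus_1 theta_plus_tau)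
  then show ?thesis
    by (simp add: theta_0)
qed

lemma nz_theta: "Im \<tau> > 0 \<Longrightarrow> nz_meromorphic (theta \<tau>)"
  using theta_nonzero nz_meromorphic_holomorphic holomorphic_theta by metis

text \<open>The zeros of \<open>theta\<close> on the lattice cancel the simple zeros of
  \<open>theta_prod\<close>, and the multipliers agree, so the quotient extends to an entire
  elliptic function. Its constant value is not 0, so both functions have the same orders.\<close>

lemma zorder_theta:
  assumes "Im \<tau> > 0"
  shows "zorder (theta \<tau>) z = (if z \<in> period_lattice \<tau> 1 then 1 else 0)"
proof -
  let ?f = "\<lambda>z. theta \<tau> z / theta_prod \<tau> z"
  note nz = nz_theta [OF assms] nz_theta_prod [OF assms]
  have nzf: "nz_meromorphic ?f"
    using nz by (rule nz_meromorphic_divide)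
  have "zorder ?f z \<ge> 0" for z
  proof -
    have "zorder (theta \<tau>) z \<ge> 0" "z \<in> period_lattice \<tau> 1 \<Longrightarrow> zorder (theta \<tau>) z > 0"
      using zorder_entire_nonneg [OF nz(1) holomorphic_theta [OF assms], of z]
        zorder_entire_pos_iff [OF nz(1) holomorphic_theta [OF assms], of z] theta_lattice [of z \<tau>] by auto
    then show ?thesis
      using zorder_nz_divide [OF nz, of z] zorder_theta_prod [OF assms, of z] by auto
  qed
  then obtain F where F: "F holomorphic_on UNIV" "\<forall>\<^sub>\<approx>z. F z = ?f z"
    using zorder_nonneg_imp_entire [OF nzf] by blast
  have shift: "F (z + w) = F z" if "\<And>z. ?f (z + w) = ?f z" for z w
  proof -
    have "\<forall>\<^sub>\<approx>z. F (z + w) = F z"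
      using F(2) cosparse_shift [OF F(2), of w] by eventually_elim (use that in metis)
    moreover have "(\<lambda>z. F (z + w)) holomorphic_on UNIV"
      using holomorphic_on_compose_gen [OF _ F(1), of "\<lambda>z. z + w" UNIV]
      by (simp add: o_def holomorphic_on_add)
    ultimately have "(\<lambda>z. F (z + w)) = F"
      by (intro holomorphic_cosparse_eq F)
    then show ?thesis by metis
  qed
  have "F (z + of_nat 1) = F z" "F (z + of_nat 1 * \<tau>) = F z" for z
    by (intro shift; simp add: theta_plus_1 theta_plus_tau theta_prod_plus_1 theta_prod_plus_tau [OF assms])+
  then obtain C where C: "\<And>z. F z = C"
    using elliptic_entire_constant [OF assms, of 1 F] F(1) by (metis zero_less_one)
  have eq: "\<forall>\<^sub>\<approx>z. theta \<tau> z = C * theta_prod \<tau> z"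
  proof -
    have "\<forall>\<^sub>\<approx>z. theta_prod \<tau> z \<noteq> 0"
      using nz(2) by (simp add: nz_meromorphic_def)
    with F(2) show ?thesis
      by eventually_elim (auto simp: C field_simps)
  qed
  have "C \<noteq> 0"
  proof
    assume "C = 0"
    then have "\<forall>\<^sub>\<approx>z. theta \<tau> z = 0"
      using eq by simp
    moreover have "\<forall>\<^sub>\<approx>z. theta \<tau> z \<noteq> 0"
      using nz(1) by (simp add: nz_meromorphic_def)
    ultimately have "\<forall>\<^sub>\<approx>z::complex. False"
      by eventually_elim simp
    then show False by simp
  qed
  then have "zorder (\<lambda>z. C * theta_prod \<tau> z) z = zorder (theta_prod \<tau>) z"
    using zorder_nz_mult [OF nz_meromorphic_const nz(2)] by simp
  then show ?thesis
    using zorder_cosparse_cong [OF eq, of z] zorder_theta_prod [OF assms] by simp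
qed

section \<open>Theta products\<close>

lemma theta_k_plus_period: "k > 0 \<Longrightarrow> theta_k \<tau> k (z + of_nat k) = theta_k \<tau> k z"
  using theta_plus_1 [of \<tau> "z / of_nat k"] by (simp add: theta_k_def add_divide_distrib)

lemma theta_k_plus_tau:
  assumes "k > 0"
  shows "theta_k \<tau> k (z + of_nat k * \<tau>) =
    exp (of_real pi * \<i> - 2 * \<i> * of_real pi * z / of_nat k) * theta_k \<tau> k z"
proof -
  have "(z + of_nat k * \<tau>) / of_nat k = z / of_nat k + \<tau>"
    using assms by (simp add: add_divide_distrib)
  moreover have "exp (of_real pi * \<i> - 2 * \<i> * of_real pi * z / of_nat k) =
      - exp (- 2 * \<i> * of_real pi * (z / of_nat k))"
    by (simp add: exp_diff exp_minus inverse_eq_divide)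
  ultimately show ?thesis
    unfolding theta_k_def by (simp only: theta_plus_tau)
qed

text \<open>Multiplication by a Gaussian \<open>exp (a z\<^sup>2 + b z)\<close> makes the theta function periodic with respect to
  \<open>k \<tau>\<close>.\<close>

lemma theta_k_plus_int_tau:
  fixes n :: int
  assumes "k > 0" "\<tau> \<noteq> 0"
  obtains c where "c \<noteq> 0" "\<And>z. theta_k \<tau> k (z + of_int n * (of_nat k * \<tau>)) =
    c * exp (- 2 * \<i> * of_real pi * of_int n * z / of_nat k) * theta_k \<tau> k z"
proof -
  define p where "p = of_nat k * \<tau>"
  \<comment> \<open>\<open>a\<close> and \<open>b\<close> are chosen so that
    \<open>E (z + p) - E z = 2 pi i z / k - pi i\<close>, minus the exponent of the multiplier of
    \<open>theta_k\<close>.\<close>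
  define a where "a = of_real pi * \<i> / (of_nat k * p)"
  define b where "b = - of_real pi * \<i> * (1 + \<tau>) / p"
  define E where "E z = a * z ^ 2 + b * z" for z
  have "p \<noteq> 0"
    using assms by (simp add: p_def)
  then have ap: "a * p = of_real pi * \<i> / of_nat k" and bp: "b * p = - of_real pi * \<i> * (1 + \<tau>)"
    using assms by (simp_all add: a_def b_def)
  have app: "a * p * p = of_real pi * \<i> * \<tau>"
    unfolding ap using assms(1) by (simp add: p_def)
  have E_shift: "E (z + x * p) = E z + 2 * x * (a * p) * z + x ^ 2 * (a * p * p) + x * (b * p)" for z x
    by (simp add: E_def power2_eq_square algebra_simps)
  have "exp (E (z + p)) * theta_k \<tau> k (z + p) = exp (E z) * theta_k \<tau> k z" for z
  proof -
    have "E (z + p) + (of_real pi * \<i> - 2 * \<i> * of_real pi * z / of_nat k) = E z"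
      using E_shift [of z 1] unfolding app unfolding ap bp by (simp add: algebra_simps)
    then show ?thesis
      unfolding p_def theta_k_plus_tau [OF assms(1)] mult.assoc [symmetric] exp_add [symmetric] by simp
  qed
  then have per: "exp (E (z + of_int n * p)) * theta_k \<tau> k (z + of_int n * p) = exp (E z) * theta_k \<tau> k z" for z
    by (rule periodic_of_int)
  define c where "c = exp (- (of_int n ^ 2 * (a * p * p)) - of_int n * (b * p))"
  have "theta_k \<tau> k (z + of_int n * p) =
      c * exp (- 2 * \<i> * of_real pi * of_int n * z / of_nat k) * theta_k \<tau> k z" for z
  proof -
    have "theta_k \<tau> k (z + of_int n * p) = exp (E z - E (z + of_int n * p)) * theta_k \<tau> k z"
      using per [of z] by (simp add: exp_diff field_simps)
    also have "E z - E (z + of_int n * p) = (- (of_int n ^ 2 * (a * p * p)) - of_int n * (b * p)) +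
        - 2 * \<i> * of_real pi * of_int n * z / of_nat k"
      unfolding E_shift ap by (simp add: algebra_simps)
    finally show ?thesis
      by (simp only: c_def exp_add)
  qed
  with that [of c] show ?thesis
    by (simp add: c_def p_def)
qed

lemma ThetaI:
  assumes "c \<noteq> 0" "finite {\<xi>. n \<xi> \<noteq> 0}"
  shows "(\<lambda>z. c * (\<Prod>\<xi> | n \<xi> \<noteq> 0. theta_k \<tau> k (z - \<xi>) ^ n \<xi>)) \<in> Theta \<tau> k"
  unfolding Theta_def mem_Collect_eq by (rule exI [of _ c], rule exI [of _ n]) (use assms in simp)

lemma Theta_const: "c \<noteq> 0 \<Longrightarrow> (\<lambda>_. c) \<in> Theta \<tau> k"
  using ThetaI [of c "\<lambda>_. 0"] by simp

lemma Theta_translate: "(\<lambda>z. theta_k \<tau> k (z - \<xi>)) \<in> Theta \<tau> k"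
proof -
  have "{x. (if x = \<xi> then 1 else 0) \<noteq> (0 :: nat)} = {\<xi>}"
    by auto
  then show ?thesis
    using ThetaI [of 1 "\<lambda>x. if x = \<xi> then 1 else 0" \<tau> k] by simp
qed

lemma Theta_mult:
  assumes "f \<in> Theta \<tau> k" "g \<in> Theta \<tau> k"
  shows "(\<lambda>z. f z * g z) \<in> Theta \<tau> k"
proof -
  obtain c m d n where c: "c \<noteq> 0" "finite {\<xi>. m \<xi> \<noteq> 0}" "d \<noteq> 0" "finite {\<xi>. n \<xi> \<noteq> 0}"
    and f: "f = (\<lambda>z. c * (\<Prod>\<xi> | m \<xi> \<noteq> 0. theta_k \<tau> k (z - \<xi>) ^ m \<xi>))"
    and g: "g = (\<lambda>z. d * (\<Prod>\<xi> | n \<xi> \<noteq> 0. theta_k \<tau> k (z - \<xi>) ^ n \<xi>))"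
    using assms unfolding Theta_def by blast
  \<comment> \<open>Both products are taken over the union of the supports, where exponent 0
    contributes the factor 1; natural exponents cannot cancel.\<close>
  let ?S = "{\<xi>. m \<xi> + n \<xi> \<noteq> 0}"
  have "?S = {\<xi>. m \<xi> \<noteq> 0} \<union> {\<xi>. n \<xi> \<noteq> 0}"
    by auto
  then have fin: "finite ?S"
    using c by simp
  have "(\<Prod>\<xi> | l \<xi> \<noteq> 0. theta_k \<tau> k (z - \<xi>) ^ l \<xi>) = (\<Prod>\<xi>\<in>?S. theta_k \<tau> k (z - \<xi>) ^ l \<xi>)"
    if "\<And>\<xi>. l \<xi> \<noteq> 0 \<Longrightarrow> m \<xi> + n \<xi> \<noteq> 0" for l z
  proof -
    have "{\<xi>. l \<xi> \<noteq> 0} \<subseteq> ?S"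
      by (rule Collect_mono) (use that in simp)
    then show ?thesis
      by (rule prod.mono_neutral_left [OF fin]) auto
  qed
  from this [of m] this [of n]
  have "(\<lambda>z. f z * g z) = (\<lambda>z. (c * d) * (\<Prod>\<xi>\<in>?S. theta_k \<tau> k (z - \<xi>) ^ (m \<xi> + n \<xi>)))"
    by (simp add: f g power_add prod.distrib mult_ac)
  also have "\<dots> \<in> Theta \<tau> k"
    by (rule ThetaI) (use c fin in auto)
  finally show ?thesis .
qed

lemma Theta_power: "f \<in> Theta \<tau> k \<Longrightarrow> (\<lambda>z. f z ^ n) \<in> Theta \<tau> k"
  by (induction n) (auto intro: Theta_mult Theta_const)

lemma Theta_prod: "(\<And>x. x \<in> A \<Longrightarrow> f x \<in> Theta \<tau> k) \<Longrightarrow> (\<lambda>z. \<Prod>x\<in>A. f x z) \<in> Theta \<tau> k"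
  by (induction A rule: infinite_finite_induct) (auto intro: Theta_mult Theta_const)

locale theta_lattice =
  fixes \<tau> :: complex and k :: nat
  assumes Im_tau: "Im \<tau> > 0" and k_pos: "k > 0"
begin

abbreviation L :: "complex set" where
  "L \<equiv> period_lattice \<tau> k"

abbreviation \<theta> :: "complex \<Rightarrow> complex" where
  "\<theta> \<equiv> theta_k \<tau> k"

section \<open>Orders of theta products\<close>

lemma holomorphic_theta_k: "\<theta> holomorphic_on UNIV"
proof -
  have "(theta \<tau> \<circ> (\<lambda>z. z / of_nat k)) holomorphic_on UNIV"
    by (intro holomorphic_on_compose_gen [OF _ holomorphic_theta [OF Im_tau]] holomorphic_intros)
       (use k_pos in auto)
  then show ?thesis
    by (simp add: o_def theta_k_def [abs_def])
qed

lemma nz_theta_k: "nz_meromorphic \<theta>"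
proof -
  obtain z where "theta \<tau> z \<noteq> 0"
    using theta_nonzero [OF Im_tau] .
  then show ?thesis
    using k_pos by (intro nz_meromorphic_holomorphic [OF holomorphic_theta_k, of "of_nat k * z"])
      (simp add: theta_k_def)
qed

lemma zorder_theta_k: "zorder \<theta> z = (if z \<in> L then 1 else 0)"
proof -
  have "zorder (\<lambda>z. theta \<tau> ((1 / of_nat k) * z)) z = zorder (theta \<tau>) ((1 / of_nat k) * z)"
    using k_pos by (intro Meromorphic.zorder_scale nz_meromorphicD nz_theta Im_tau) auto
  then show ?thesis
    using period_lattice_divide_iff [OF k_pos, of z \<tau>]
    by (simp add: zorder_theta [OF Im_tau] theta_k_def [abs_def])
qed

lemma holomorphic_translate: "(\<lambda>z. \<theta> (z - \<xi>)) holomorphic_on UNIV"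
  using holomorphic_on_shift [OF holomorphic_theta_k, of "- \<xi>"] by simp

lemma nz_translate: "nz_meromorphic (\<lambda>z. \<theta> (z - \<xi>))"
  using nz_meromorphic_shift [OF nz_theta_k, of "- \<xi>"] by simp

lemma zorder_translate: "zorder (\<lambda>z. \<theta> (z - \<xi>)) z = (if z - \<xi> \<in> L then 1 else 0)"
  using zorder_at_shift [of \<theta> "- \<xi>" z] by (simp add: zorder_theta_k)

lemma Theta_holomorphic: "f \<in> Theta \<tau> k \<Longrightarrow> f holomorphic_on UNIV"
  unfolding Theta_def by (auto intro!: holomorphic_intros holomorphic_translate)

lemma Theta_nz: "f \<in> Theta \<tau> k \<Longrightarrow> nz_meromorphic f"
  unfolding Theta_def
  by (auto intro!: nz_meromorphic_mult nz_meromorphic_const nz_meromorphic_prod nz_meromorphic_power nz_translate)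

lemma Theta_zorder_nonneg: "f \<in> Theta \<tau> k \<Longrightarrow> zorder f z \<ge> 0"
  by (intro zorder_entire_nonneg Theta_nz Theta_holomorphic)

lemma L_add_iff: "w \<in> L \<Longrightarrow> z + w \<in> L \<longleftrightarrow> z \<in> L"
  using period_lattice_diff [of "z + w" \<tau> k w] period_lattice_add [of z \<tau> k w] by auto

text \<open>The order at \<open>z\<close> counts, with multiplicity, the \<xi> for which
  \<open>z - \<xi>\<close> is a period, and this depends only on the class of
  \<open>z\<close>.\<close>

lemma Theta_zorder_periodic:
  assumes "f \<in> Theta \<tau> k" "w \<in> L"
  shows "zorder f (z + w) = zorder f z"
proof -
  obtain c n where c: "c \<noteq> 0" and f: "f = (\<lambda>z. c * (\<Prod>\<xi> | n \<xi> \<noteq> 0. \<theta> (z - \<xi>) ^ n \<xi>))"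
    using assms(1) unfolding Theta_def by blast
  have "zorder f z = (\<Sum>\<xi> | n \<xi> \<noteq> 0. int (n \<xi>) * (if z - \<xi> \<in> L then 1 else 0))" for z
    unfolding f using c
    by (simp add: zorder_nz_mult zorder_nz_prod zorder_nz_power zorder_translate
        nz_meromorphic_const nz_meromorphic_prod nz_meromorphic_power nz_translate)
  moreover have "z + w - \<xi> \<in> L \<longleftrightarrow> z - \<xi> \<in> L" for \<xi>
    using L_add_iff [OF assms(2), of "z - \<xi>"] by (simp add: algebra_simps)
  ultimately show ?thesis by simp
qed

section \<open>Bounded representatives and divisors as periodic functions\<close>

definition rep :: "complex \<Rightarrow> complex" where
  "rep z = (SOME v. v - z \<in> L \<and> norm v \<le> of_nat k * (1 + norm \<tau>))"

lemma rep_props: "rep z - z \<in> L" "norm (rep z) \<le> of_nat k * (1 + norm \<tau>)"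
proof -
  obtain w where "w \<in> L" "norm (z - w) \<le> of_nat k * (1 + norm \<tau>)"
    using bounded_reps [OF Im_tau k_pos] by blast
  then have "(z - w) - z \<in> L \<and> norm (z - w) \<le> of_nat k * (1 + norm \<tau>)"
    using period_lattice_uminus by simp
  then have "rep z - z \<in> L \<and> norm (rep z) \<le> of_nat k * (1 + norm \<tau>)"
    unfolding rep_def by (rule someI)
  then show "rep z - z \<in> L" "norm (rep z) \<le> of_nat k * (1 + norm \<tau>)"
    by auto
qed

text \<open>The property in the choice of \<open>rep z\<close> depends on \<open>z\<close> only
  through its class, so equivalent points get the same representative.\<close>

lemma rep_eq_iff: "rep y = rep z \<longleftrightarrow> y - z \<in> L"
proof
  assume "rep y = rep z"
  then show "y - z \<in> L"
    using period_lattice_diff [OF rep_props(1) rep_props(1), of z y] by simp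
next
  assume "y - z \<in> L"
  then have "v - y \<in> L \<longleftrightarrow> v - z \<in> L" for v
    using L_add_iff [of "y - z" "v - y"] by simp
  then show "rep y = rep z"
    by (simp add: rep_def)
qed

lemma rep_rep [simp]: "rep (rep z) = rep z"
  by (simp add: rep_eq_iff rep_props)

definition periodic :: "(complex \<Rightarrow> 'a) \<Rightarrow> bool" where
  "periodic n \<longleftrightarrow> (\<forall>w\<in>L. \<forall>z. n (z + w) = n z)"

lemma periodicD: "periodic n \<Longrightarrow> w \<in> L \<Longrightarrow> n (z + w) = n z"
  by (auto simp: periodic_def)

lemma periodic_rep: "periodic n \<Longrightarrow> n (rep z) = n z"
  using periodicD [of n "rep z - z" z] rep_props(1) by simp

text \<open>Divisors on the torus are encoded as \<^term>\<open>L\<close>-periodic functions; the sums and products over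
  the torus run over \<^term>\<open>range rep\<close>.\<close>

definition supp :: "(complex \<Rightarrow> int) \<Rightarrow> complex set" where
  "supp n = {\<xi> \<in> range rep. n \<xi> \<noteq> 0}"

definition deg :: "(complex \<Rightarrow> int) \<Rightarrow> int" where
  "deg n = (\<Sum>\<xi>\<in>supp n. n \<xi>)"

text \<open>A lift of the weight to the plane. The complex number itself, and not just its class,
  enters the multiplier of \<open>theta_of\<close>.\<close>

definition wt :: "(complex \<Rightarrow> int) \<Rightarrow> complex" where
  "wt n = (\<Sum>\<xi>\<in>supp n. of_int (n \<xi>) * \<xi>)"

text \<open>The standard theta product with divisor \<open>n\<close>; its order is computed for
  nonnegative \<open>n\<close>, where \<open>nat\<close> loses nothing.\<close>

definition theta_of :: "(complex \<Rightarrow> int) \<Rightarrow> complex \<Rightarrow> complex" where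
  "theta_of n z = (\<Prod>\<xi>\<in>supp n. \<theta> (z - \<xi>) ^ nat (n \<xi>))"

text \<open>All representatives lie in one compact disc, which meets a sparse set in finitely many
  points.\<close>

lemma finite_supp:
  assumes "\<forall>\<^sub>\<approx>z. n z = 0"
  shows "finite (supp n)"
proof -
  have "{z. n z \<noteq> 0} sparse_in UNIV"
    using assms by (simp add: eventually_cosparse)
  then have "finite (cball 0 (of_nat k * (1 + norm \<tau>)) \<inter> {z. n z \<noteq> 0})"
    by (intro sparse_in_compact_finite) (auto elim: sparse_in_subset)
  then show ?thesis
    by (rule finite_subset [rotated]) (auto simp: supp_def rep_props)
qed

lemma deg_mono_neutral:
  assumes "finite A" "supp n \<subseteq> A" "A \<subseteq> range rep"
  shows "deg n = (\<Sum>\<xi>\<in>A. n \<xi>)" "wt n = (\<Sum>\<xi>\<in>A. of_int (n \<xi>) * \<xi>)"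
  unfolding deg_def wt_def
  using assms by (auto intro!: sum.mono_neutral_left simp: supp_def)

lemma deg_wt_diff:
  assumes "finite (supp m)" "finite (supp n)"
  shows "deg (\<lambda>z. m z - n z) = deg m - deg n" "wt (\<lambda>z. m z - n z) = wt m - wt n"
proof -
  let ?A = "supp m \<union> supp n"
  have A: "finite ?A" "?A \<subseteq> range rep" "supp m \<subseteq> ?A" "supp n \<subseteq> ?A" "supp (\<lambda>z. m z - n z) \<subseteq> ?A"
    using assms by (auto simp: supp_def)
  note eqs = deg_mono_neutral [OF A(1) _ A(2)]
  show "deg (\<lambda>z. m z - n z) = deg m - deg n" "wt (\<lambda>z. m z - n z) = wt m - wt n"
    unfolding eqs [OF A(3)] eqs [OF A(4)] eqs [OF A(5)]
    by (simp_all add: sum_subtractf algebra_simps)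
qed

lemma theta_of_Theta: "theta_of n \<in> Theta \<tau> k"
  unfolding theta_of_def [abs_def] by (intro Theta_prod Theta_power Theta_translate)

lemma zorder_theta_of:
  assumes "finite (supp n)" "periodic n" "\<And>z. n z \<ge> 0"
  shows "zorder (theta_of n) z = n z"
proof -
  have "zorder (theta_of n) z = (\<Sum>\<xi>\<in>supp n. int (nat (n \<xi>)) * (if z - \<xi> \<in> L then 1 else 0))"
    unfolding theta_of_def [abs_def]
    by (simp add: zorder_nz_prod zorder_nz_power zorder_translate nz_meromorphic_power nz_translate)
  \<comment> \<open>Among the representatives, only that of the class of \<open>z\<close>
    contributes.\<close>
  also have "\<dots> = (\<Sum>\<xi>\<in>supp n. if \<xi> = rep z then n \<xi> else 0)"
  proof (rule sum.cong)
    fix \<xi> assume "\<xi> \<in> supp n"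
    then have "rep \<xi> = \<xi>"
      by (auto simp: supp_def)
    then show "int (nat (n \<xi>)) * (if z - \<xi> \<in> L then 1 else 0) = (if \<xi> = rep z then n \<xi> else 0)"
      using rep_eq_iff [of z \<xi>] assms(3) by auto
  qed simp
  also have "\<dots> = n (rep z)"
    using assms(1) by (auto simp: supp_def)
  also have "\<dots> = n z"
    by (rule periodic_rep [OF assms(2)])
  finally show ?thesis .
qed

lemma theta_of_plus_k: "theta_of n (z + of_nat k) = theta_of n z"
  unfolding theta_of_def
  using theta_k_plus_period [OF k_pos, of \<tau> "z - \<xi>" for \<xi>] by (simp add: algebra_simps)

text \<open>The multipliers of the translates \<open>\<theta> (z - \<xi>)\<close> have affine
  exponents; summing them turns the slope into the degree and the \<xi> into the weight.\<close>

lemma theta_of_plus_tau: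
  assumes "\<And>z. n z \<ge> 0"
  shows "theta_of n (z + of_nat k * \<tau>) =
    exp (of_int (deg n) * (of_real pi * \<i> - 2 * \<i> * of_real pi * z / of_nat k) +
         2 * \<i> * of_real pi * wt n / of_nat k) * theta_of n z"
proof -
  let ?e = "\<lambda>\<xi>. of_real pi * \<i> - 2 * \<i> * of_real pi * (z - \<xi>) / of_nat k"
  have "\<theta> (z + of_nat k * \<tau> - \<xi>) = exp (?e \<xi>) * \<theta> (z - \<xi>)" for \<xi>
    using theta_k_plus_tau [OF k_pos, of \<tau> "z - \<xi>"] by (simp add: algebra_simps)
  then have "theta_of n (z + of_nat k * \<tau>) =
      (\<Prod>\<xi>\<in>supp n. exp (?e \<xi>) ^ nat (n \<xi>)) * theta_of n z"
    by (simp add: theta_of_def power_mult_distrib prod.distrib)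
  also have "(\<Prod>\<xi>\<in>supp n. exp (?e \<xi>) ^ nat (n \<xi>)) = (\<Prod>\<xi>\<in>supp n. exp (of_int (n \<xi>) * ?e \<xi>))"
  proof (rule prod.cong [OF refl])
    fix \<xi>
    have "of_int (n \<xi>) = (of_nat (nat (n \<xi>)) :: complex)"
      using assms [of \<xi>] by simp
    then show "exp (?e \<xi>) ^ nat (n \<xi>) = exp (of_int (n \<xi>) * ?e \<xi>)"
      by (simp only: exp_of_nat_mult)
  qed
  \<comment> \<open>For an infinite support both sides are 1 by convention.\<close>
  also have "\<dots> = exp (\<Sum>\<xi>\<in>supp n. of_int (n \<xi>) * ?e \<xi>)"
    by (cases "finite (supp n)") (simp_all add: exp_sum)
  also have "(\<Sum>\<xi>\<in>supp n. of_int (n \<xi>) * ?e \<xi>) =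
      (\<Sum>\<xi>\<in>supp n. of_int (n \<xi>) * (of_real pi * \<i> - 2 * \<i> * of_real pi * z / of_nat k) +
        2 * \<i> * of_real pi / of_nat k * (of_int (n \<xi>) * \<xi>))"
    by (intro sum.cong) (use k_pos in \<open>simp_all add: field_simps\<close>)
  also have "\<dots> = of_int (deg n) * (of_real pi * \<i> - 2 * \<i> * of_real pi * z / of_nat k) +
         2 * \<i> * of_real pi / of_nat k * wt n"
    by (simp only: of_int_sum sum.distrib deg_def wt_def flip: sum_distrib_left sum_distrib_right)
  finally show ?thesis by simp
qed

section \<open>Divisors on the torus\<close>

abbreviation "cls \<equiv> torus_class \<tau> k"

lemma cls_eq: "cls z = {w. w - z \<in> L}"
proof -
  have "cls z = (\<lambda>v. v + z) ` L"
    by (auto simp: torus_class_def r_coset_def complex_add_def)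
  also have "\<dots> = {w. w - z \<in> L}"
  proof (intro equalityI subsetI)
    fix w assume "w \<in> {w. w - z \<in> L}"
    then show "w \<in> (\<lambda>v. v + z) ` L"
      by (intro image_eqI [of _ _ "w - z"]) auto
  qed auto
  finally show ?thesis .
qed

lemma cls_eq_iff: "cls y = cls z \<longleftrightarrow> y - z \<in> L"
proof
  assume "cls y = cls z"
  moreover have "y \<in> cls y"
    by (simp add: cls_eq period_lattice_0)
  ultimately show "y - z \<in> L"
    by (simp add: cls_eq)
next
  assume *: "y - z \<in> L"
  have "w - y \<in> L \<longleftrightarrow> w - z \<in> L" for w
    using L_add_iff [OF *, of "w - y"] by simp
  then show "cls y = cls z"
    by (simp add: cls_eq)
qed

lemma carrier_torus: "carrier (torus \<tau> k) = range cls"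
  by (auto simp: torus_def FactGroup_def RCOSETS_def torus_class_def complex_add_def)

lemma cls_carrier: "cls z \<in> carrier (torus \<tau> k)"
  by (simp add: carrier_torus)

sublocale torus: comm_group "torus \<tau> k"
  by (rule comm_group_torus)

lemma cls_mult: "cls x \<otimes>\<^bsub>torus \<tau> k\<^esub> cls y = cls (x + y)"
proof -
  interpret A: comm_group complex_add
    by (rule comm_group_complex_add)
  have "period_lattice \<tau> k \<lhd> complex_add"
    by (rule A.subgroup_imp_normal [OF subgroup_period_lattice])
  then have "(period_lattice \<tau> k #>\<^bsub>complex_add\<^esub> x) <#>\<^bsub>complex_add\<^esub> (period_lattice \<tau> k #>\<^bsub>complex_add\<^esub> y) =
      period_lattice \<tau> k #>\<^bsub>complex_add\<^esub> (x \<otimes>\<^bsub>complex_add\<^esub> y)"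
    by (rule normal.rcos_sum) (auto simp: complex_add_def)
  then show ?thesis
    by (simp add: torus_def torus_class_def FactGroup_def complex_add_def)
qed

lemma cls_zero: "cls 0 = \<one>\<^bsub>torus \<tau> k\<^esub>"
  using cls_mult [of 0 0] torus.r_cancel_one [OF cls_carrier cls_carrier] by simp

lemma cls_nat_pow: "cls x [^]\<^bsub>torus \<tau> k\<^esub> (n :: nat) = cls (of_nat n * x)"
  by (induction n) (simp_all add: cls_zero cls_mult algebra_simps)

lemma cls_int_pow: "cls x [^]\<^bsub>torus \<tau> k\<^esub> (n :: int) = cls (of_int n * x)"
proof (cases n rule: int_cases2)
  case (nonneg m)
  then show ?thesis
    by (simp add: int_pow_int cls_nat_pow)
next
  case (nonpos m)
  have "cls (- (of_nat m * x)) \<otimes>\<^bsub>torus \<tau> k\<^esub> cls (of_nat m * x) = \<one>\<^bsub>torus \<tau> k\<^esub>"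
    by (simp add: cls_mult cls_zero)
  then have "inv\<^bsub>torus \<tau> k\<^esub> cls (of_nat m * x) = cls (- (of_nat m * x))"
    by (rule torus.inv_equality) (rule cls_carrier)+
  with nonpos show ?thesis
    by (simp add: torus.int_pow_neg_int cls_carrier cls_nat_pow)
qed

lemma finprod_cls:
  "finite A \<Longrightarrow> (\<Otimes>\<^bsub>torus \<tau> k\<^esub>x\<in>A. cls (g x)) = cls (\<Sum>x\<in>A. g x)"
  by (induction A rule: finite_induct) (simp_all add: cls_zero cls_mult cls_carrier torus.finprod_insert)

text \<open>Periodicity makes the set of orders along a class a singleton, so
  \<open>the_elem\<close> returns the common value.\<close>

lemma theta_div_cls:
  assumes "periodic (zorder f)"
  shows "theta_div \<tau> k f (cls z) = zorder f z"
proof -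
  have "zorder f w = zorder f z" if "w \<in> cls z" for w
    using that periodicD [OF assms, of "w - z" z] by (simp add: cls_eq)
  moreover have "z \<in> cls z"
    by (simp add: cls_eq period_lattice_0)
  ultimately have "zorder f ` cls z = {zorder f z}"
    by blast
  then show ?thesis
    by (simp add: theta_div_def ord_class_def cls_carrier)
qed

lemma theta_div_le:
  assumes "periodic (zorder f)" "periodic (zorder g)" "\<And>z. zorder f z \<le> zorder g z"
  shows "theta_div \<tau> k f \<le> theta_div \<tau> k g"
proof (rule le_funI)
  fix C
  show "theta_div \<tau> k f C \<le> theta_div \<tau> k g C"
  proof (cases "C \<in> carrier (torus \<tau> k)")
    case True
    then obtain z where "C = cls z"
      by (auto simp: carrier_torus)
    then show ?thesis
      using assms by (simp add: theta_div_cls)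
  qed (simp add: theta_div_def)
qed

lemma inj_on_cls: "inj_on cls (supp n)"
proof (rule inj_onI)
  fix x y assume xy: "x \<in> supp n" "y \<in> supp n" and "cls x = cls y"
  then have "rep x = rep y"
    by (simp only: rep_eq_iff cls_eq_iff)
  moreover have "rep x = x" "rep y = y"
    using xy by (auto simp: supp_def)
  ultimately show "x = y" by metis
qed

text \<open>Together with \<open>inj_on_cls\<close> this transports sums and products over classes
  to \<open>supp\<close>.\<close>

lemma theta_div_support:
  assumes "periodic (zorder f)"
  shows "{C. theta_div \<tau> k f C \<noteq> 0} = cls ` supp (zorder f)"
proof (intro equalityI subsetI)
  fix C assume "C \<in> {C. theta_div \<tau> k f C \<noteq> 0}"
  then have C: "theta_div \<tau> k f C \<noteq> 0" by simp
  then obtain z where z: "C = cls z"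
    by (auto simp: theta_div_def carrier_torus split: if_splits)
  have "cls (rep z) = cls z"
    by (simp add: cls_eq_iff rep_props)
  moreover have "rep z \<in> supp (zorder f)"
    using C z periodic_rep [OF assms, of z] by (simp add: supp_def theta_div_cls [OF assms])
  ultimately show "C \<in> cls ` supp (zorder f)"
    using z by blast
qed (auto simp: theta_div_cls [OF assms] supp_def)

lemma theta_deg_eq:
  assumes "periodic (zorder f)"
  shows "theta_deg \<tau> k f = deg (zorder f)"
  unfolding theta_deg_def theta_div_support [OF assms] deg_def
  by (simp add: sum.reindex [OF inj_on_cls] theta_div_cls [OF assms])

lemma theta_weight_eq:
  assumes "periodic (zorder f)" "finite (supp (zorder f))"
  shows "theta_weight \<tau> k f = cls (wt (zorder f))"
proof -
  have "theta_weight \<tau> k f =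
      (\<Otimes>\<^bsub>torus \<tau> k\<^esub>x\<in>supp (zorder f). cls x [^]\<^bsub>torus \<tau> k\<^esub> theta_div \<tau> k f (cls x))"
    unfolding theta_weight_def theta_div_support [OF assms(1)]
    by (rule torus.finprod_reindex [where f = "\<lambda>C. C [^]\<^bsub>torus \<tau> k\<^esub> theta_div \<tau> k f C", OF _ inj_on_cls])
      (auto simp: cls_int_pow cls_carrier)
  also have "\<dots> = cls (wt (zorder f))"
    unfolding cls_int_pow theta_div_cls [OF assms(1)] wt_def by (rule finprod_cls [OF assms(2)])
  finally show ?thesis .
qed

text \<open>Moving one zero \<xi> to \<open>\<xi> + j k \<tau>\<close> multiplies its theta factor
  by a constant times the wanted exponential; nonempty support supplies the zero.\<close>

lemma theta_of_exp_Theta: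
  assumes "finite (supp n)" "supp n \<noteq> {}" "\<And>z. n z \<ge> 0"
  shows "(\<lambda>z. exp (2 * \<i> * of_real pi * of_int j * z / of_nat k) * theta_of n z) \<in> Theta \<tau> k"
proof -
  obtain \<xi> where \<xi>: "\<xi> \<in> supp n"
    using assms(2) by blast
  then have "n \<xi> > 0"
    using assms(3) [of \<xi>] by (simp add: supp_def)
  then obtain m where m: "nat (n \<xi>) = Suc m"
    by (metis gr0_implies_Suc zero_less_nat_eq)
  have "\<tau> \<noteq> 0"
    using Im_tau by auto
  then obtain c where c: "c \<noteq> 0" "\<And>z. \<theta> (z + of_int (- j) * (of_nat k * \<tau>)) =
      c * exp (- 2 * \<i> * of_real pi * of_int (- j) * z / of_nat k) * \<theta> z"
    using theta_k_plus_int_tau [OF k_pos] by blast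
  \<comment> \<open>\<open>?d\<close> removes the constant \<open>c\<close> and restores the
    exponential at \<xi>, since the translation yields \<open>z - \<xi>\<close> in the exponent
    instead of \<open>z\<close>.\<close>
  let ?d = "inverse c * exp (2 * \<i> * of_real pi * of_int j * \<xi> / of_nat k)"
  let ?v = "\<xi> + of_int j * (of_nat k * \<tau>)"
  let ?g = "\<lambda>z. \<theta> (z - \<xi>) ^ m * (\<Prod>x\<in>supp n - {\<xi>}. \<theta> (z - x) ^ nat (n x))"
  have "exp (2 * \<i> * of_real pi * of_int j * z / of_nat k) * \<theta> (z - \<xi>) = ?d * \<theta> (z - ?v)" for z
  proof -
    have "z - ?v = (z - \<xi>) + of_int (- j) * (of_nat k * \<tau>)"
      by simp
    then have "?d * \<theta> (z - ?v) = exp (2 * \<i> * of_real pi * of_int j * \<xi> / of_nat k) *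
        exp (- 2 * \<i> * of_real pi * of_int (- j) * (z - \<xi>) / of_nat k) * \<theta> (z - \<xi>)"
      using c by (simp only: c(2)) (simp add: field_simps)
    also have "exp (2 * \<i> * of_real pi * of_int j * \<xi> / of_nat k) *
        exp (- 2 * \<i> * of_real pi * of_int (- j) * (z - \<xi>) / of_nat k) =
        exp (2 * \<i> * of_real pi * of_int j * z / of_nat k)"
      unfolding exp_add [symmetric]
      by (rule arg_cong [where f = exp]) (use k_pos in \<open>simp add: field_simps\<close>)
    finally show ?thesis by simp
  qed
  moreover have "theta_of n z = \<theta> (z - \<xi>) * ?g z" for z
    unfolding theta_of_def by (subst prod.remove [OF assms(1) \<xi>]) (simp add: m mult_ac)
  ultimately have "(\<lambda>z. exp (2 * \<i> * of_real pi * of_int j * z / of_nat k) * theta_of n z) =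
      (\<lambda>z. ?d * \<theta> (z - ?v) * ?g z)"
    by (simp add: mult.assoc [symmetric])
  also have "\<dots> \<in> Theta \<tau> k"
    by (intro Theta_mult Theta_const Theta_translate Theta_power Theta_prod) (use c(1) in auto)
  finally show ?thesis .
qed

lemma zorder_shift_fun: "zorder (shift h f) z = zorder f (z + h)"
  by (simp add: shift_def zorder_at_shift)

lemma Theta_shift_periodic:
  assumes "f \<in> Theta \<tau> k"
  shows "periodic (zorder (shift h f))"
  unfolding periodic_def zorder_shift_fun
proof (intro ballI allI)
  fix w z assume "w \<in> L"
  then have "zorder f (z + h + w) = zorder f (z + h)"
    by (rule Theta_zorder_periodic [OF assms])
  then show "zorder f (z + w + h) = zorder f (z + h)"
    by (simp add: add_ac)
qed

section \<open>The Riccati equation\<close>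

text \<open>Where \<open>p2\<close> is nonzero, the equation forces its factor \<open>u\<close> to
  be nonzero.\<close>

lemma riccati_nz:
  assumes "u meromorphic_on UNIV" "p2 \<in> Theta \<tau> k"
    and "\<forall>\<^sub>\<approx>z. (u (z + h) * p3 z + p1 z) * u z = - p2 z"
  shows "nz_meromorphic u"
proof (rule nz_meromorphic_cong [OF assms(1) Theta_nz [OF assms(2)]])
  show "\<forall>\<^sub>\<approx>z. p2 z \<noteq> 0 \<longrightarrow> u z \<noteq> 0"
    using assms(3) by eventually_elim auto
qed

text \<open>Both bounds come from the order of a sum. The first bounds the bracket,
  \<open>p1\<close> and \<open>p3\<close> being entire; the second isolates the term with
  \<open>p3\<close> as \<open>- p2 - p1 u\<close>.\<close>

lemma riccati_zorder:
  assumes u: "nz_meromorphic u" and p1: "p1 \<in> Theta \<tau> k \<union> {\<lambda>_. 0}"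
    and p2: "p2 \<in> Theta \<tau> k" and p3: "p3 \<in> Theta \<tau> k"
    and eq: "\<forall>\<^sub>\<approx>z. (u (z + h) * p3 z + p1 z) * u z = - p2 z"
  shows "zorder p2 z \<ge> min 0 (zorder u (z + h)) + zorder u z"
    and "zorder p3 z \<ge> min 0 (zorder u z) - zorder u z - zorder u (z + h)"
proof -
  note nz2 = Theta_nz [OF p2] and nz3 = Theta_nz [OF p3]
  have nz_uh: "nz_meromorphic (\<lambda>z. u (z + h) * p3 z)"
    by (rule nz_meromorphic_mult [OF nz_meromorphic_shift [OF u] nz3])
  have zo_uh: "zorder (\<lambda>z. u (z + h) * p3 z) z = zorder u (z + h) + zorder p3 z"
    by (simp add: zorder_nz_mult nz_meromorphic_shift u nz3 zorder_at_shift)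
  have p1_cases: "p1 = (\<lambda>_. 0) \<or> nz_meromorphic p1 \<and> zorder p1 z \<ge> 0"
    using p1 Theta_nz Theta_zorder_nonneg by auto
  have mero1: "p1 meromorphic_on UNIV"
    using p1_cases nz_meromorphicD(1) by auto
  \<comment> \<open>Signs are written as factors \<open>- 1\<close> so that the product rules for
    orders apply.\<close>
  have nzm2: "nz_meromorphic (\<lambda>z. - 1 * p2 z)"
    by (intro nz_meromorphic_mult nz_meromorphic_const nz2) simp
  have zom2: "zorder (\<lambda>z. - 1 * p2 z) z = zorder p2 z"
    by (subst zorder_nz_mult [OF nz_meromorphic_const nz2]) simp_all

  let ?g = "\<lambda>z. u (z + h) * p3 z + p1 z"
  have nzg: "nz_meromorphic ?g"
  proof (rule nz_meromorphic_cong [OF _ nz2])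
    show "?g meromorphic_on UNIV"
      by (intro meromorphic_on_add nz_meromorphicD(1) [OF nz_uh] mero1)
    show "\<forall>\<^sub>\<approx>z. p2 z \<noteq> 0 \<longrightarrow> ?g z \<noteq> 0"
      using eq by eventually_elim auto
  qed
  have "zorder ?g z \<ge> min 0 (zorder u (z + h))"
    using p1_cases Theta_zorder_nonneg [OF p3, of z]
    by (intro zorder_nz_add_ge [OF nz_uh nzg]) (auto simp: zo_uh)
  moreover have "zorder p2 z = zorder ?g z + zorder u z"
  proof -
    have "zorder (\<lambda>z. - 1 * p2 z) z = zorder (\<lambda>z. ?g z * u z) z"
      by (rule zorder_cosparse_cong) (use eq in eventually_elim, simp)
    then show ?thesis
      unfolding zom2 zorder_nz_mult [OF nzg u] .
  qed
  ultimately show "zorder p2 z \<ge> min 0 (zorder u (z + h)) + zorder u z"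
    by linarith

  let ?r = "\<lambda>z. - 1 * p2 z + - 1 * (p1 z * u z)"
  let ?l = "\<lambda>z. u (z + h) * p3 z * u z"
  have nzl: "nz_meromorphic ?l"
    by (rule nz_meromorphic_mult [OF nz_uh u])
  have lr: "\<forall>\<^sub>\<approx>z. ?r z = ?l z"
    using eq by eventually_elim (simp add: algebra_simps)
  have nzr: "nz_meromorphic ?r"
  proof (rule nz_meromorphic_cong [OF _ nzl])
    show "?r meromorphic_on UNIV"
      by (intro meromorphic_intros nz_meromorphicD(1) [OF nz2] nz_meromorphicD(1) [OF u] mero1)
    show "\<forall>\<^sub>\<approx>z. ?l z \<noteq> 0 \<longrightarrow> ?r z \<noteq> 0"
      using lr by eventually_elim simp
  qed
  have second: "(\<lambda>z. - 1 * (p1 z * u z)) = (\<lambda>_. 0) \<or>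
      nz_meromorphic (\<lambda>z. - 1 * (p1 z * u z)) \<and> zorder (\<lambda>z. - 1 * (p1 z * u z)) z \<ge> min 0 (zorder u z)"
  proof (cases "p1 = (\<lambda>_. 0)")
    case False
    then have nz1: "nz_meromorphic p1" "zorder p1 z \<ge> 0"
      using p1_cases by auto
    have nzpu: "nz_meromorphic (\<lambda>z. p1 z * u z)"
      by (rule nz_meromorphic_mult [OF nz1(1) u])
    have "zorder (\<lambda>z. - 1 * (p1 z * u z)) z = zorder p1 z + zorder u z"
      by (subst zorder_nz_mult [OF nz_meromorphic_const nzpu])
         (simp_all add: zorder_nz_mult [OF nz1(1) u])
    with nz1 show ?thesis
      by (intro disjI2 conjI nz_meromorphic_mult nz_meromorphic_const nzpu) auto
  qed simp
  have "min 0 (zorder u z) \<le> zorder ?r z"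
    using second Theta_zorder_nonneg [OF p2, of z]
    by (intro zorder_nz_add_ge [OF nzm2 nzr]) (auto simp only: zom2)
  also have "zorder ?r z = zorder ?l z"
    by (rule zorder_cosparse_cong [OF lr])
  also have "\<dots> = zorder u (z + h) + zorder p3 z + zorder u z"
    unfolding zorder_nz_mult [OF nz_uh u] zo_uh ..
  finally show "zorder p3 z \<ge> min 0 (zorder u z) - zorder u z - zorder u (z + h)"
    by linarith
qed

lemma periodic_comp2: "periodic f \<Longrightarrow> periodic g \<Longrightarrow> periodic (\<lambda>z. F (f z) (g z))"
  by (simp add: periodic_def)

lemma periodic_shift:
  assumes "periodic f"
  shows "periodic (\<lambda>z. f (z + a))"
  using periodicD [OF assms, of _ "z + a" for z] by (simp add: periodic_def add_ac)

text \<open>Divided by the theta quotient with the same divisor, \<open>u\<close> becomes a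
  zero-free entire function, to which \<open>nonvanishing_quasi_periodic\<close> applies. The
  identity of exponentials is kept so that absolute values can determine \<open>n\<close> when the
  degree of \<rho> and the two weights vanish.\<close>

lemma theta_factorization:
  assumes u: "nz_meromorphic u" and per: "periodic u"
    and nonneg: "\<And>z. \<rho> z \<ge> 0" "\<And>z. \<pi> z \<ge> 0" "\<And>z. \<kappa> z \<ge> 0"
    and fin: "finite (supp \<rho>)" "finite (supp \<pi>)" "finite (supp \<kappa>)"
    and pers: "periodic \<rho>" "periodic \<pi>" "periodic \<kappa>"
    and ord: "\<And>z. zorder u z = \<rho> (z + h) - \<rho> z + (\<pi> z - \<kappa> z)"
  obtains c :: complex and n :: int where "c \<noteq> 0" "deg \<pi> = deg \<kappa>"
    "wt \<pi> - wt \<kappa> - of_int (deg \<rho>) * h \<in> L"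
    "exp (2 * \<i> * of_real pi * of_int n * \<tau>) =
       exp (2 * \<i> * of_real pi * (of_int (deg \<rho>) * h - (wt \<pi> - wt \<kappa>)) / of_nat k)"
    "\<forall>\<^sub>\<approx>z. u z = theta_of \<rho> (z + h) / theta_of \<rho> z *
       (c * (exp (2 * \<i> * of_real pi * of_int n * z / of_nat k) * theta_of \<pi> z) / theta_of \<kappa> z)"
proof -
  let ?S = "\<lambda>z. theta_of \<rho> (z + h) / theta_of \<rho> z * (theta_of \<pi> z / theta_of \<kappa> z)"
  let ?f = "\<lambda>z. u z / ?S z"
  note nzT = Theta_nz [OF theta_of_Theta]
  note nzR = nz_meromorphic_shift [OF nzT [of \<rho>], of h]
  note nzRR = nz_meromorphic_divide [OF nzR nzT [of \<rho>]] and nzPK = nz_meromorphic_divide [OF nzT [of \<pi>] nzT [of \<kappa>]]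
  have nzS: "nz_meromorphic ?S"
    by (rule nz_meromorphic_mult [OF nzRR nzPK])
  have nzf: "nz_meromorphic ?f"
    by (rule nz_meromorphic_divide [OF u nzS])
  have zS: "zorder ?S z = zorder u z" for z
    unfolding ord zorder_nz_mult [OF nzRR nzPK] zorder_nz_divide [OF nzR nzT] zorder_nz_divide [OF nzT nzT]
    by (simp add: zorder_at_shift zorder_theta_of nonneg fin pers)
  have zf: "zorder ?f z = 0" for z
    unfolding zorder_nz_divide [OF u nzS] zS by simp
  obtain F where F: "F holomorphic_on UNIV" "\<forall>\<^sub>\<approx>z. F z = ?f z"
    by (rule zorder_nonneg_imp_entire [OF nzf]) (simp only: zf order_refl)
  have nzF: "nz_meromorphic F"
  proof (rule nz_meromorphic_cong [OF _ nzf])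
    show "F meromorphic_on UNIV"
      using F(1) by (simp add: analytic_on_imp_meromorphic_on analytic_on_open)
    show "\<forall>\<^sub>\<approx>z. ?f z \<noteq> 0 \<longrightarrow> F z \<noteq> 0"
      using F(2) by eventually_elim simp
  qed
  have F_nz: "F z \<noteq> 0" for z
    using zorder_entire_pos_iff [OF nzF F(1), of z] zorder_cosparse_cong [OF F(2), of z] zf [of z] by simp
  \<comment> \<open>\<open>F\<close> agrees with \<open>?f\<close> only off a sparse set; holomorphy
    extends its functional equations to every point.\<close>
  have F_shift: "F (z + w) = e z * F z"
    if "\<And>z. ?f (z + w) = e z * ?f z" "e holomorphic_on UNIV" for z w e
  proof -
    have "\<forall>\<^sub>\<approx>z. F (z + w) = e z * F z"
      using F(2) cosparse_shift [OF F(2), of w] by eventually_elim (simp only: that(1))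
    then have "(\<lambda>z. F (z + w)) = (\<lambda>z. e z * F z)"
      by (intro holomorphic_cosparse_eq holomorphic_on_shift [OF F(1)] holomorphic_on_mult F(1) that(2))
    then show ?thesis by metis
  qed
  define D W d where "D = deg \<pi> - deg \<kappa>" and "W = wt \<pi> - wt \<kappa>" and "d = deg \<rho>"
  \<comment> \<open>\<open>\<alpha> z + \<beta>\<close> is the exponent of the multiplier of
    \<open>F\<close> under \<open>k \<tau>\<close>. As \<open>u\<close> is periodic, it is minus the
    exponent for \<open>?S\<close>; its slope comes from \<open>D\<close>, its constant term from
    \<open>D\<close>, \<open>W\<close> and \<open>d h\<close>.\<close>
  define \<alpha> where "\<alpha> = 2 * \<i> * of_real pi * of_int D / of_nat k"
  define \<beta> where "\<beta> = 2 * \<i> * of_real pi * (of_int d * h - W) / of_nat k - of_int D * (of_real pi * \<i>)"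
  have u_plus: "u (z + of_nat k) = u z" "u (z + of_nat k * \<tau>) = u z" for z
    using periodicD [OF per, of _ z] period_latticeI [of k 1 0 \<tau>] period_latticeI [of k 0 1 \<tau>] by simp_all
  have S_plus_k: "?S (z + of_nat k) = ?S z" for z
    using theta_of_plus_k [of \<rho> "z + h"] theta_of_plus_k [of _ z] by (simp add: add_ac)
  have S_plus_tau: "exp (\<alpha> * z + \<beta>) * ?S (z + of_nat k * \<tau>) = ?S z" for z
  proof -
    let ?A = "\<lambda>n z. of_int (deg n) * (of_real pi * \<i> - 2 * \<i> * of_real pi * z / of_nat k) +
         2 * \<i> * of_real pi * wt n / of_nat k"
    have R: "theta_of \<rho> (z + of_nat k * \<tau> + h) = exp (?A \<rho> (z + h)) * theta_of \<rho> (z + h)"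
      using theta_of_plus_tau [OF nonneg(1), where z = "z + h"] by (simp add: add_ac)
    have "?S (z + of_nat k * \<tau>) = exp (?A \<rho> (z + h) - ?A \<rho> z + (?A \<pi> z - ?A \<kappa> z)) * ?S z"
      unfolding R theta_of_plus_tau [OF nonneg(1)] theta_of_plus_tau [OF nonneg(2)]
        theta_of_plus_tau [OF nonneg(3)]
      by (simp only: exp_add [of "_ - _" "_ - _"] exp_diff times_divide_times_eq mult_ac)
    moreover have "?A \<rho> (z + h) - ?A \<rho> z + (?A \<pi> z - ?A \<kappa> z) = - (\<alpha> * z + \<beta>)"
      using k_pos by (simp add: \<alpha>_def \<beta>_def D_def W_def d_def field_simps)
    ultimately have S: "?S (z + of_nat k * \<tau>) = exp (- (\<alpha> * z + \<beta>)) * ?S z"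
      by (simp only:)
    have "exp (\<alpha> * z + \<beta>) * exp (- (\<alpha> * z + \<beta>)) = 1"
      by (simp only: exp_add [symmetric] add.right_inverse exp_zero)
    then show ?thesis
      unfolding S mult.assoc [symmetric] by (simp only: mult_1)
  qed
  have f_plus_k: "?f (z + of_nat k) = ?f z" for z
    by (simp only: u_plus S_plus_k)
  have f_plus_tau: "?f (z + of_nat k * \<tau>) = exp (\<alpha> * z + \<beta>) * ?f z" for z
    unfolding u_plus S_plus_tau [symmetric, of z] by (simp add: field_simps)
  have F_plus_k: "F (z + of_nat k) = F z" for z
    using F_shift [of "of_nat k" "\<lambda>_. 1" z] f_plus_k by simp
  have F_plus_tau: "F (z + of_nat k * \<tau>) = exp (\<alpha> * z + \<beta>) * F z" for z
    by (rule F_shift [OF f_plus_tau]) (intro holomorphic_intros)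
  \<comment> \<open>The vanishing of \<alpha> is the equality of the degrees of \<pi> and
    \<kappa>.\<close>
  obtain n :: int where "\<alpha> = 0"
    and Fn: "\<And>z. F z = F 0 * exp (2 * \<i> * of_real pi * of_int n * z / of_nat k)"
    using nonvanishing_quasi_periodic [OF Im_tau k_pos F(1) F_nz F_plus_k F_plus_tau] by blast
  have "D = 0"
    using \<open>\<alpha> = 0\<close> k_pos by (simp add: \<alpha>_def)
  have expn: "exp (2 * \<i> * of_real pi * of_int n * \<tau>) =
       exp (2 * \<i> * of_real pi * (of_int d * h - W) / of_nat k)"
  proof -
    have "F 0 * exp (2 * \<i> * of_real pi * of_int n * \<tau>) = F (0 + of_nat k * \<tau>)"
      using Fn [of "of_nat k * \<tau>"] k_pos by (simp add: mult.assoc)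
    also have "\<dots> = F 0 * exp (2 * \<i> * of_real pi * (of_int d * h - W) / of_nat k)"
      unfolding F_plus_tau by (simp add: \<beta>_def \<open>D = 0\<close>)
    finally show ?thesis
      using F_nz [of 0] by simp
  qed
  \<comment> \<open>Exponents of equal exponentials differ by 2 pi i m, so \<open>W - d h\<close> is
    the lattice element \<open>k (m - n \<tau>)\<close>.\<close>
  then obtain m :: int where "2 * \<i> * of_real pi * of_int n * \<tau> =
      2 * \<i> * of_real pi * (of_int d * h - W) / of_nat k + (of_int (2 * m) * of_real pi) * \<i>"
    unfolding exp_eq by auto
  then have "2 * \<i> * of_real pi * (W - of_int d * h) =
      2 * \<i> * of_real pi * (of_nat k * (of_int m + of_int (- n) * \<tau>))"
    using k_pos by (simp add: field_simps)
  then have "W - of_int d * h = of_nat k * (of_int m + of_int (- n) * \<tau>)"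
    by simp
  then have inL: "W - of_int d * h \<in> L"
    by (simp only: period_latticeI)
  have "\<forall>\<^sub>\<approx>z. ?S z \<noteq> 0"
    using nzS unfolding nz_meromorphic_def by blast
  with F(2) have "\<forall>\<^sub>\<approx>z. u z = F z * ?S z"
    by eventually_elim (simp add: field_simps)
  then have "\<forall>\<^sub>\<approx>z. u z = theta_of \<rho> (z + h) / theta_of \<rho> z *
       (F 0 * (exp (2 * \<i> * of_real pi * of_int n * z / of_nat k) * theta_of \<pi> z) / theta_of \<kappa> z)"
  proof eventually_elim
    case (elim z)
    also have "F z = F 0 * exp (2 * \<i> * of_real pi * of_int n * z / of_nat k)"
      by (rule Fn)
    finally show ?case
      by (simp add: mult_ac)
  qed
  with that [OF F_nz [of 0] _ _ _ this] \<open>D = 0\<close> inL expn show ?thesis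
    unfolding D_def W_def d_def by simp
qed

lemma riccati_solution:
  assumes nontorsion: "\<And>n::nat. n > 0 \<Longrightarrow> of_nat n * h \<notin> L"
    and p1: "p1 \<in> Theta \<tau> k \<union> {\<lambda>_. 0}" and p2: "p2 \<in> Theta \<tau> k" and p3: "p3 \<in> Theta \<tau> k"
    and mero: "u meromorphic_on UNIV" and per: "periodic u"
    and eq: "\<forall>\<^sub>\<approx>z. (u (z + h) * p3 z + p1 z) * u z = - p2 z"
  shows "\<exists>p\<in>Theta \<tau> k. \<exists>q\<in>Theta \<tau> k. \<exists>r\<in>Theta \<tau> k.
           (\<forall>\<^sub>\<approx>z. u z = shift h r z / r z * (p z / q z)) \<and>
           theta_div \<tau> k p \<le> theta_div \<tau> k p2 \<and>
           theta_div \<tau> k q \<le> theta_div \<tau> k (shift (- h) p3) \<and>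
           theta_deg \<tau> k p = theta_deg \<tau> k q \<and>
           theta_weight \<tau> k (\<lambda>z. p z / q z) = torus_class \<tau> k (of_int (theta_deg \<tau> k r) * h)"
proof -
  note u = riccati_nz [OF mero p2 eq]
  define \<mu> where "\<mu> z = zorder u z" for z
  \<comment> \<open>\<open>max 0 (\<mu> z)\<close> and \<open>max 0 (- \<mu> z)\<close> are the
    divisors of zeros and of poles of \<open>u\<close>, and \<open>min\<close> is their gcd after
    the shift. What \<rho> leaves of them is \<pi> and \<kappa>.\<close>
  define \<rho> where "\<rho> z = min (max 0 (\<mu> (z - h))) (max 0 (- \<mu> z))" for z
  define \<pi> where "\<pi> z = max 0 (\<mu> z) - \<rho> (z + h)" for z
  define \<kappa> where "\<kappa> z = max 0 (- \<mu> z) - \<rho> z" for z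
  have \<rho>h: "\<rho> (z + h) = min (max 0 (\<mu> z)) (max 0 (- \<mu> (z + h)))" for z
    by (simp add: \<rho>_def)
  have nonneg: "\<rho> z \<ge> 0" "\<pi> z \<ge> 0" "\<kappa> z \<ge> 0" for z
    by (simp_all add: \<rho>h \<pi>_def \<kappa>_def) (simp_all add: \<rho>_def)
  have \<mu>0: "\<forall>\<^sub>\<approx>z. \<mu> z = 0"
    unfolding \<mu>_def by (rule zorder_eq_0_cosparse [OF u])
  have "\<forall>\<^sub>\<approx>z. \<rho> z = 0" "\<forall>\<^sub>\<approx>z. \<pi> z = 0" "\<forall>\<^sub>\<approx>z. \<kappa> z = 0"
    using \<mu>0 by (eventually_elim, simp add: \<rho>_def \<rho>h \<pi>_def \<kappa>_def)+
  note fin = this [THEN finite_supp]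
  have per_\<mu>: "periodic \<mu>"
  proof -
    have "zorder u (z + w) = zorder u z" if "w \<in> L" for z w
    proof -
      have "zorder u (z + w) = zorder (\<lambda>z. u (z + w)) z"
        by (simp add: zorder_at_shift)
      then show ?thesis
        by (simp add: periodicD [OF per that])
    qed
    then show ?thesis
      by (simp add: \<mu>_def periodic_def)
  qed
  have per\<rho>: "periodic \<rho>"
    unfolding \<rho>_def [abs_def]
    using periodic_comp2 [OF periodic_shift [OF per_\<mu>, of "- h"] per_\<mu>,
        of "\<lambda>x y. min (max 0 x) (max 0 (- y))"] by simp
  have per\<pi>: "periodic \<pi>"
    unfolding \<pi>_def [abs_def]
    by (rule periodic_comp2 [OF per_\<mu> periodic_shift [OF per\<rho>], of "\<lambda>x y. max 0 x - y"])
  have per\<kappa>: "periodic \<kappa>"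
    unfolding \<kappa>_def [abs_def]
    by (rule periodic_comp2 [OF per_\<mu> per\<rho>, of "\<lambda>x y. max 0 (- x) - y"])
  have ord: "zorder u z = \<rho> (z + h) - \<rho> z + (\<pi> z - \<kappa> z)" for z
    by (simp add: \<pi>_def \<kappa>_def \<mu>_def)
  obtain c n where c: "c \<noteq> 0" and deg: "deg \<pi> = deg \<kappa>"
    and wt: "wt \<pi> - wt \<kappa> - of_int (deg \<rho>) * h \<in> L"
    and expn: "exp (2 * \<i> * of_real pi * of_int n * \<tau>) =
       exp (2 * \<i> * of_real pi * (of_int (deg \<rho>) * h - (wt \<pi> - wt \<kappa>)) / of_nat k)"
    and u_eq: "\<forall>\<^sub>\<approx>z. u z = theta_of \<rho> (z + h) / theta_of \<rho> z *
       (c * (exp (2 * \<i> * of_real pi * of_int n * z / of_nat k) * theta_of \<pi> z) / theta_of \<kappa> z)"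
    by (rule theta_factorization [OF u per nonneg fin per\<rho> per\<pi> per\<kappa> ord])
  let ?p = "\<lambda>z. c * (exp (2 * \<i> * of_real pi * of_int n * z / of_nat k) * theta_of \<pi> z)"
  have p_Theta: "?p \<in> Theta \<tau> k"
  proof (cases "supp \<pi> = {}")
    case False
    with c show ?thesis
      by (intro Theta_mult Theta_const theta_of_exp_Theta fin nonneg)
  next
    \<comment> \<open>Here \<open>theta_of \<pi>\<close> is the empty product, with no zero to
      absorb the exponential, so \<open>n = 0\<close> is shown.\<close>
    case True
    then have "deg \<pi> = 0" "wt \<pi> = 0"
      by (simp_all add: deg_def wt_def)
    \<comment> \<open>A nonnegative divisor of degree 0 is 0, so the weight of \<kappa> vanishes as
      well.\<close>
    have "\<kappa> x = 0" if "x \<in> supp \<kappa>" for x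
      using deg \<open>deg \<pi> = 0\<close> that sum_nonneg_eq_0_iff [OF fin(3), of \<kappa>] nonneg(3) by (simp add: deg_def)
    then have "supp \<kappa> = {}"
      by (auto simp: supp_def)
    then have "wt \<kappa> = 0"
      by (simp add: wt_def)
    have "deg \<rho> \<ge> 0"
      unfolding deg_def by (intro sum_nonneg nonneg)
    moreover have "of_nat (nat (deg \<rho>)) * h \<in> L"
      using period_lattice_uminus [OF wt] \<open>wt \<pi> = 0\<close> \<open>wt \<kappa> = 0\<close> \<open>deg \<rho> \<ge> 0\<close> by simp
    ultimately have "deg \<rho> = 0"
      using nontorsion [of "nat (deg \<rho>)"] by linarith
    \<comment> \<open>The modulus is exp (- 2 pi n Im \<tau>), and Im \<tau> > 0.\<close>
    then have "norm (exp (2 * \<i> * of_real pi * of_int n * \<tau>)) = 1"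
      unfolding expn \<open>wt \<pi> = 0\<close> \<open>wt \<kappa> = 0\<close> by simp
    then have "n = 0"
      using Im_tau by simp
    then show ?thesis
      using c by (simp add: Theta_mult Theta_const theta_of_Theta)
  qed
  have zp: "zorder ?p = \<pi>"
  proof
    fix z
    let ?e = "\<lambda>z. c * exp (2 * \<i> * of_real pi * of_int n * z / of_nat k)"
    have e: "?e holomorphic_on UNIV" "?e z \<noteq> 0"
      using c k_pos by (auto intro!: holomorphic_intros)
    have "zorder ?p z = zorder (\<lambda>z. ?e z * theta_of \<pi> z) z"
      by (simp add: mult.assoc)
    also have "\<dots> = zorder ?e z + zorder (theta_of \<pi>) z"
      by (rule zorder_nz_mult [OF nz_meromorphic_holomorphic [OF e] Theta_nz [OF theta_of_Theta]])
    also have "\<dots> = \<pi> z"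
      by (simp add: zorder_entire_nonzero [OF e] zorder_theta_of [OF fin(2) per\<pi> nonneg(2)])
    finally show "zorder ?p z = \<pi> z" .
  qed
  have zq: "zorder (theta_of \<kappa>) = \<kappa>" and zr: "zorder (theta_of \<rho>) = \<rho>"
    by (auto simp: fun_eq_iff zorder_theta_of fin per\<kappa> per\<rho> nonneg)
  have zpq: "zorder (\<lambda>z. ?p z / theta_of \<kappa> z) = (\<lambda>z. \<pi> z - \<kappa> z)"
    using zorder_nz_divide [OF Theta_nz [OF p_Theta] Theta_nz [OF theta_of_Theta]]
    by (simp only: fun_eq_iff zp zq simp_thms)
  \<comment> \<open>\<pi> is 0 or \<open>\<mu> z + min 0 (\<mu> (z + h))\<close>, and the order of
    \<open>p2\<close> bounds both.\<close>
  have "\<pi> z \<le> zorder p2 z" for z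
    using riccati_zorder(1) [OF u p1 p2 p3 eq, of z] Theta_zorder_nonneg [OF p2, of z]
    unfolding \<pi>_def \<rho>h \<mu>_def [symmetric] by linarith
  then have div_p: "theta_div \<tau> k ?p \<le> theta_div \<tau> k p2"
    using Theta_zorder_periodic [OF p2] per\<pi> by (intro theta_div_le) (auto simp: zp periodic_def)
  \<comment> \<open>The second estimate is used at \<open>z - h\<close>, since \<kappa> compares the
    poles at \<open>z\<close> with the zeros at \<open>z - h\<close>.\<close>
  have "\<kappa> z \<le> zorder p3 (z - h)" for z
    using riccati_zorder(2) [OF u p1 p2 p3 eq, of "z - h"] Theta_zorder_nonneg [OF p3, of "z - h"]
    unfolding \<kappa>_def \<rho>_def \<mu>_def [symmetric] diff_add_cancel by linarith
  then have div_q: "theta_div \<tau> k (theta_of \<kappa>) \<le> theta_div \<tau> k (shift (- h) p3)"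
    using per\<kappa> by (intro theta_div_le Theta_shift_periodic p3) (auto simp: zq zorder_shift_fun)
  have per_pq: "periodic (\<lambda>z. \<pi> z - \<kappa> z)"
    by (rule periodic_comp2 [OF per\<pi> per\<kappa>])
  have "supp (\<lambda>z. \<pi> z - \<kappa> z) \<subseteq> supp \<pi> \<union> supp \<kappa>"
    by (auto simp: supp_def)
  then have "finite (supp (\<lambda>z. \<pi> z - \<kappa> z))"
    using fin finite_subset by blast
  then have "theta_weight \<tau> k (\<lambda>z. ?p z / theta_of \<kappa> z) = cls (wt \<pi> - wt \<kappa>)"
    using theta_weight_eq [of "\<lambda>z. ?p z / theta_of \<kappa> z"] per_pq fin
    unfolding zpq by (simp add: deg_wt_diff)
  also have "\<dots> = cls (of_int (theta_deg \<tau> k (theta_of \<rho>)) * h)"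
    using wt theta_deg_eq [of "theta_of \<rho>"] per\<rho> by (simp add: cls_eq_iff zr)
  finally have weight: "theta_weight \<tau> k (\<lambda>z. ?p z / theta_of \<kappa> z) =
      cls (of_int (theta_deg \<tau> k (theta_of \<rho>)) * h)" .
  have degs: "theta_deg \<tau> k ?p = theta_deg \<tau> k (theta_of \<kappa>)"
    using theta_deg_eq [of ?p] theta_deg_eq [of "theta_of \<kappa>"] deg per\<pi> per\<kappa> by (simp only: zp zq)
  show ?thesis
    by (intro bexI [OF _ p_Theta] bexI [OF _ theta_of_Theta [of \<kappa>]] bexI [OF _ theta_of_Theta [of \<rho>]] conjI)
       (use u_eq div_p div_q degs weight in \<open>simp_all only: shift_def\<close>)
qed

end

theorem proposition4p5:
  fixes \<tau> h :: complex and k :: nat and a b u p1 p2 p3 :: "complex \<Rightarrow> complex"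
  assumes "Im \<tau> > 0"
    and "\<And>n::nat. n > 0 \<Longrightarrow> of_nat n * h \<notin> period_lattice \<tau> 1"
    and "a \<in> periodic_mero (period_lattice \<tau> 1)"
    and "b \<in> periodic_mero (period_lattice \<tau> 1) - {\<lambda>_. 0}"
    and "k \<ge> 1"
    and "p1 \<in> Theta \<tau> k \<union> {\<lambda>_. 0}" and "p2 \<in> Theta \<tau> k" and "p3 \<in> Theta \<tau> k"
    and "\<forall>\<^sub>\<approx>z. a z = p1 z / p3 z"
    and "\<forall>\<^sub>\<approx>z. b z = p2 z / p3 z"
    and "u \<in> periodic_mero (period_lattice \<tau> k)"
    and "\<forall>\<^sub>\<approx>z. (shift h u z + a z) * u z = - b z"
  shows "\<exists>p\<in>Theta \<tau> k. \<exists>q\<in>Theta \<tau> k. \<exists>r\<in>Theta \<tau> k.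
           (\<forall>\<^sub>\<approx>z. u z = shift h r z / r z * (p z / q z)) \<and>
           theta_div \<tau> k p \<le> theta_div \<tau> k p2 \<and>
           theta_div \<tau> k q \<le> theta_div \<tau> k (shift (- h) p3) \<and>
           theta_deg \<tau> k p = theta_deg \<tau> k q \<and>
           theta_weight \<tau> k (\<lambda>z. p z / q z) = torus_class \<tau> k (of_int (theta_deg \<tau> k r) * h)"
proof -
  interpret theta_lattice \<tau> k
    using assms(1,5) by unfold_locales auto
  \<comment> \<open>Off the sparse zero set of \<open>p3\<close>, multiplication by
    \<open>p3\<close> clears the denominators of \<open>a\<close> and \<open>b\<close>.\<close>
  have "\<forall>\<^sub>\<approx>z. p3 z \<noteq> 0"
    using Theta_nz [OF assms(8)] by (simp add: nz_meromorphic_def)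
  with assms(9,10,12) have "\<forall>\<^sub>\<approx>z. (u (z + h) * p3 z + p1 z) * u z = - p2 z"
  proof eventually_elim
    case (elim z)
    then have "p1 z = a z * p3 z" "p2 z = b z * p3 z"
      by auto
    then have "(u (z + h) * p3 z + p1 z) * u z = p3 z * ((shift h u z + a z) * u z)"
      by (simp add: shift_def algebra_simps)
    also have "\<dots> = - p2 z"
      unfolding elim(3) \<open>p2 z = b z * p3 z\<close> by simp
    finally show ?case .
  qed
  \<comment> \<open>The lattice for \<open>k\<close> is contained in the lattice for 1, so
    non-torsion passes to it.\<close>
  moreover have "of_nat n * h \<notin> period_lattice \<tau> k" if "n > 0" for n
    using assms(2) [OF that] period_lattice_subset_1 by blast
  moreover have "u meromorphic_on UNIV" "periodic u"
    using assms(11) by (auto simp: periodic_mero_def periodic_def nicely_meromorphic_on_def)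
  ultimately show ?thesis
    using assms(6,7,8) by (intro riccati_solution)
qed

end
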